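(* Let $D$ be the set of all $w\in\{-1,1\}^{\mathbb{N}}$ such that $\sum_{i\le n}w_i=-1$ for some $n\ge 1$, and let $f:D^c\to\{A,B\}$ be the blame function defined by the four-step procedure described in the context. Then $f$ correctly identifies Deviator with probability $1$, regardless of Deviator's strategy. That is: if one of the two players (Honest) chooses each of his or her moves uniformly at random in $\{-1,1\}$ independently of the past, and the other player (Deviator) uses an arbitrary behavior strategy, then the probability that $w\in D^c$ and $f(w)$ is Honest equals $0$.
   Context: Two players $A$ and $B$ generate a sequence $w=(w_1,w_2,\dots)\in\{-1,1\}^{\mathbb{N}}$, one term per period; player $A$ chooses the terms with odd index and player $B$ chooses those with even index, each player observing all previous terms. A behavior strategy of a player assigns to each finite history after which that player moves a probability distribution on $\{-1,1\}$ for the next term. Each player is supposed to choose $1$ with probability $1/2$ in each of his or her periods, independently of the past. The player who does so is called Honest, and the other player is called Deviator. Notation: write $w=(a_1,b_1,a_2,b_2,\dots)$, so $a_n$ and $b_n$ are the $n$-th moves of $A$ and $B$. Let $A_n=\sum_{i=1}^n a_i$, $B_n=\sum_{i=1}^n b_i$. Let $s_n=1+\sum_{i\le n}w_i$ be the position at time $n$ of the walk started at $1$; thus $s_0=1$, $s_{2n}=1+A_n+B_n$ and $s_{2n-1}=1+A_n+B_{n-1}$ for $n\ge1$. Definition of $f(w)$ for $w\in D^c$ (the procedure stops as soon as a player is chosen, and $f(w)$ is the chosen player; a series "diverges" if its partial sums do not converge to a finite limit, and "$=\infty$" means that the partial sums tend to $+\infty$): Step 1. If $\limsup_{n\to\infty}\frac{A_n}{\sqrt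 n\log\log n}>0$, choose $A$. Otherwise, if $\limsup_{n\to\infty}\frac{B_n}{\sqrt n\log\log n}>0$, choose $B$. Step 2. If $\sum_{n=2}^\infty\frac{a_n}{\sqrt n(\log n)^{3/4}}$ diverges, choose $A$. Otherwise, if $\sum_{n=2}^\infty\frac{b_n}{\sqrt n(\log n)^{3/4}}$ diverges, choose $B$. Step 3. If $\sum_{n=1}^\infty\frac{s_{2n+1}^2-s_{2n}^2}{2n\log(2n)}=\infty$, choose $B$. Otherwise, if $\sum_{n=2}^\infty\frac{s_{2n}^2-s_{2n-1}^2}{(2n-1)\log(2n-1)}=\infty$, choose $A$. Step 4. Otherwise, choose $A$. *)

theory Defs
  imports "HOL-Probability.Probability"
begin

datatype player = PlayerA | PlayerB

text \<open>A sequence \<open>(w\<^sub>1, w\<^sub>2, \<dots>)\<close> is a function \<open>w :: nat \<Rightarrow> int\<close> whose value at \<open>k\<close> is the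
  term of index \<open>k + 1\<close>; accordingly a history is the list of all terms chosen so far, in
  chronological order.\<close>

definition sign_seqs :: "(nat \<Rightarrow> int) set" where
  "sign_seqs = UNIV \<rightarrow> {-1, 1}"

text \<open>After a history of length \<open>k\<close> the term with index \<open>k + 1\<close> is chosen.\<close>

definition mover :: "int list \<Rightarrow> player" where
  "mover h = (if odd (length h + 1) then PlayerA else PlayerB)"

type_synonym strategy = "int list \<Rightarrow> int pmf"

text \<open>The values of a strategy of \<open>p\<close> at histories after which \<open>p\<close> does not move are irrelevant.\<close>

definition behavior_strategy :: "player \<Rightarrow> strategy \<Rightarrow> bool" where
  "behavior_strategy p \<sigma> \<longleftrightarrow>
     (\<forall>h. set h \<subseteq> {-1, 1} \<and> mover h = p \<longrightarrow> set_pmf (\<sigma> h) \<subseteq> {-1, 1})"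

definition honest_strategy :: strategy where
  "honest_strategy h = pmf_of_set {-1, 1}"

definition next_move :: "(player \<Rightarrow> strategy) \<Rightarrow> int list \<Rightarrow> int pmf" where
  "next_move S h = S (mover h) h"

lemma measurable_prefix:
  "(\<lambda>w. map w [0..<n]) \<in> (\<Pi>\<^sub>M i\<in>{0..<n}. count_space (UNIV :: int set)) \<rightarrow>\<^sub>M count_space UNIV"
proof (rule measurable_count_space_eq2_countable[THEN iffD2], intro conjI ballI)
  fix h :: "int list"
  let ?M = "\<Pi>\<^sub>M i\<in>{0..<n}. count_space (UNIV :: int set)"
  have "(\<lambda>w. map w [0..<n]) -` {h} \<inter> space ?M =
      (if length h = n then \<Pi>\<^sub>E i\<in>{0..<n}. {h ! i} else {})"
  proof (cases "length h = n")
    case True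
    then have "map w [0..<n] = h \<longleftrightarrow> (\<forall>i\<in>{0..<n}. w i = h ! i)" for w
      by (simp add: list_eq_iff_nth_eq Ball_def)
    with True show ?thesis
      unfolding space_PiM by (simp add: set_eq_iff PiE_iff conj_commute)
  next
    case False
    then show ?thesis by auto
  qed
  moreover have "(\<Pi>\<^sub>E i\<in>{0..<n}. {h ! i}) \<in> sets ?M"
    by (rule sets_PiM_I_finite) simp_all
  ultimately show "(\<lambda>w. map w [0..<n]) -` {h} \<inter> space ?M \<in> sets ?M"
    by simp
qed simp_all

interpretation play: Ionescu_Tulcea
  "\<lambda>n w. measure_pmf (next_move S (map w [0..<n]))" "\<lambda>_. count_space (UNIV :: int set)"
  for S :: "player \<Rightarrow> strategy"
proof
  show "(\<lambda>w. measure_pmf (next_move S (map w [0..<n])))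
      \<in> (\<Pi>\<^sub>M i\<in>{0..<n}. count_space UNIV) \<rightarrow>\<^sub>M subprob_algebra (count_space UNIV)" for n
    by (rule measurable_compose[OF measurable_prefix])
       (auto simp: space_subprob_algebra intro: prob_space_imp_subprob_space prob_space_measure_pmf)
qed

text \<open>The law of the play when player \<open>p\<close> uses the strategy \<open>S p\<close>: the Ionescu-Tulcea measure of
  the kernels \<open>next_move S\<close>. It is determined by the cylinder probabilities in
  \<open>measure_play_law_cylinder\<close>.\<close>

definition play_law :: "(player \<Rightarrow> strategy) \<Rightarrow> (nat \<Rightarrow> int) measure" where
  "play_law S = play.PF.lim S"

lemma sets_play_law: "sets (play_law S) = sets (\<Pi>\<^sub>M i\<in>UNIV. count_space UNIV)"
  by (simp add: play_law_def play.PF.sets_lim)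

lemma space_play_law: "space (play_law S) = UNIV"
  using sets_eq_imp_space_eq[OF sets_play_law] by (auto simp: space_PiM)

lemma prob_space_play_law: "prob_space (play_law S)"
proof
  have 1: "emeasure (play_law S) (play.PF.emb UNIV {} (space (\<Pi>\<^sub>M i\<in>{}. count_space UNIV))) =
      emeasure (play.CI S {}) (space (\<Pi>\<^sub>M i\<in>{}. count_space UNIV))"
    unfolding play_law_def by (rule play.lim[OF finite.emptyI sets.top])
  have 2: "space (play.CI S {}) = space (\<Pi>\<^sub>M i\<in>{}. count_space (UNIV :: int set))"
    by (rule play.PF.space_P[OF finite.emptyI empty_subsetI])
  have 3: "emeasure (play.CI S {}) (space (play.CI S {})) = 1"
    by (rule prob_space.emeasure_space_1[OF play.PF.prob_space_P[OF finite.emptyI empty_subsetI]])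
  have 4: "play.PF.emb UNIV {} (space (\<Pi>\<^sub>M i\<in>{}. count_space (UNIV :: int set))) = UNIV"
    by (auto simp: prod_emb_def space_PiM)
  show "emeasure (play_law S) (space (play_law S)) = 1"
    using 1 3 unfolding 2 4 space_play_law by simp
qed

lemma emeasure_prefix:
  assumes "n \<le> length h"
  shows "emeasure (play.C S 0 n (\<lambda>x. undefined)) (\<Pi>\<^sub>E i\<in>{0..<n}. {h ! i}) =
    ennreal (\<Prod>k<n. pmf (next_move S (take k h)) (h ! k))"
  using assms
proof (induction n)
  case 0
  show ?case by (simp add: PiM_empty)
next
  case (Suc n)
  let ?C = "play.C S 0 n (\<lambda>x. undefined)"
  let ?M = "\<lambda>n. \<Pi>\<^sub>M i\<in>{0..<n}. count_space (UNIV :: int set)"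
  let ?X = "\<lambda>n. \<Pi>\<^sub>E i\<in>{0..<n}. {h ! i}"
  let ?p = "pmf (next_move S (take n h)) (h ! n)"
  have X: "?X m \<in> sets (?M m)" for m
    by (intro sets_PiM_I_finite) auto
  have sp: "space ?C = space (?M n)" and se: "sets ?C = sets (?M n)"
    using play.space_C[of "\<lambda>x. undefined" 0 S n] play.sets_C[of "\<lambda>x. undefined" 0 S n]
    by (simp_all add: space_PiM)
  have eP: "emeasure (play.eP S n \<omega>) (?X (Suc n)) = ennreal ?p * indicator (?X n) \<omega>"
    if \<omega>: "\<omega> \<in> space (?M n)" for \<omega>
  proof (cases "\<omega> \<in> ?X n")
    case True
    have "map \<omega> [0..<n] = take n h"
      using True Suc.prems by (intro nth_equalityI) (simp_all add: PiE_iff)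
    moreover have "fun_upd \<omega> n -` ?X (Suc n) = {h ! n}"
      using True by (auto simp: PiE_iff extensional_def less_Suc_eq split: if_splits)
    ultimately show ?thesis
      using True by (subst play.emeasure_eP[OF \<omega> X]) (simp add: emeasure_pmf_single)
  next
    case False
    have "fun_upd \<omega> n -` ?X (Suc n) = {}"
      using False \<omega> by (auto simp: PiE_iff space_PiM less_Suc_eq split: if_splits)
    then show ?thesis
      using False by (subst play.emeasure_eP[OF \<omega> X]) simp
  qed
  have "emeasure (play.C S 0 (Suc n) (\<lambda>x. undefined)) (?X (Suc n)) =
      (\<integral>\<^sup>+\<omega>. emeasure (play.eP S n \<omega>) (?X (Suc n)) \<partial>?C)"
    using play.measurable_eP[of S n]
    by (simp, subst emeasure_bind[where N="?M (Suc n)"])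
       (auto simp: sp se X space_PiM cong: measurable_cong_sets)
  also have "\<dots> = (\<integral>\<^sup>+\<omega>. ennreal ?p * indicator (?X n) \<omega> \<partial>?C)"
    by (intro nn_integral_cong eP) (simp add: sp)
  also have "\<dots> = ennreal ?p * emeasure ?C (?X n)"
    by (subst nn_integral_cmult_indicator) (simp_all add: se X)
  also have "\<dots> = ennreal (\<Prod>k<Suc n. pmf (next_move S (take k h)) (h ! k))"
    using Suc by (simp add: ennreal_mult[symmetric] prod_nonneg mult.commute)
  finally show ?case .
qed

lemma measure_play_law_cylinder:
  "measure (play_law S) {w. \<forall>k<length h. w k = h ! k} =
     (\<Prod>k<length h. pmf (next_move S (take k h)) (h ! k))"
proof -
  let ?J = "{0..<length h}"
  let ?X = "\<Pi>\<^sub>E i\<in>?J. {h ! i}"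
  have X: "?X \<in> sets (\<Pi>\<^sub>M i\<in>?J. count_space UNIV)"
    by (intro sets_PiM_I_finite) auto
  have "{w. \<forall>k<length h. w k = h ! k} = play.PF.emb UNIV ?J ?X"
    by (auto simp: prod_emb_def PiE_iff space_PiM)
  then have "emeasure (play_law S) {w. \<forall>k<length h. w k = h ! k} = emeasure (play.CI S ?J) ?X"
    using play.lim[OF _ X] by (simp add: play_law_def)
  also have "\<dots> = emeasure (play.C S 0 (length h) (\<lambda>x. undefined)) ?X"
    by (subst play.emeasure_CI[OF order_refl X]) (simp add: prod_emb_id[OF sets.sets_into_space[OF X, simplified space_PiM]])
  also have "\<dots> = ennreal (\<Prod>k<length h. pmf (next_move S (take k h)) (h ! k))"
    by (rule emeasure_prefix) simp
  finally show ?thesis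
    by (simp add: measure_def prod_nonneg)
qed

text \<open>From here on indices start at 1, so \<open>term_at w n\<close> is \<open>w\<^sub>n\<close> for \<open>n \<ge> 1\<close>.\<close>

definition term_at :: "(nat \<Rightarrow> int) \<Rightarrow> nat \<Rightarrow> int" where
  "term_at w n = w (n - 1)"

definition move_A :: "(nat \<Rightarrow> int) \<Rightarrow> nat \<Rightarrow> int" where
  "move_A w n = term_at w (2 * n - 1)"

definition move_B :: "(nat \<Rightarrow> int) \<Rightarrow> nat \<Rightarrow> int" where
  "move_B w n = term_at w (2 * n)"

definition sum_A :: "(nat \<Rightarrow> int) \<Rightarrow> nat \<Rightarrow> int" where
  "sum_A w n = (\<Sum>i=1..n. move_A w i)"

definition sum_B :: "(nat \<Rightarrow> int) \<Rightarrow> nat \<Rightarrow> int" where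
  "sum_B w n = (\<Sum>i=1..n. move_B w i)"

definition walk :: "(nat \<Rightarrow> int) \<Rightarrow> nat \<Rightarrow> int" where
  "walk w n = 1 + (\<Sum>i=1..n. term_at w i)"

definition D_set :: "(nat \<Rightarrow> int) set" where
  "D_set = {w \<in> sign_seqs. \<exists>n\<ge>1. (\<Sum>i=1..n. term_at w i) = -1}"

definition series_diverges :: "nat \<Rightarrow> (nat \<Rightarrow> real) \<Rightarrow> bool" where
  "series_diverges m c \<longleftrightarrow> \<not> convergent (\<lambda>N. \<Sum>n=m..N. c n)"

definition series_infinite :: "nat \<Rightarrow> (nat \<Rightarrow> real) \<Rightarrow> bool" where
  "series_infinite m c \<longleftrightarrow> filterlim (\<lambda>N. \<Sum>n=m..N. c n) at_top sequentially"

text \<open>The function is total, but only its values on \<open>sign_seqs - D_set\<close> are meaningful. The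
  quotients in the limsups have conventional values for \<open>n \<le> 2\<close>, which do not matter.\<close>

definition blame :: "(nat \<Rightarrow> int) \<Rightarrow> player" where
  "blame w =
    (if limsup (\<lambda>n. ereal (sum_A w n / (sqrt n * ln (ln n)))) > 0 then PlayerA
     else if limsup (\<lambda>n. ereal (sum_B w n / (sqrt n * ln (ln n)))) > 0 then PlayerB
     else if series_diverges 2 (\<lambda>n. move_A w n / (sqrt n * ln n powr (3/4))) then PlayerA
     else if series_diverges 2 (\<lambda>n. move_B w n / (sqrt n * ln n powr (3/4))) then PlayerB
     else if series_infinite 1 (\<lambda>n. ((walk w (2*n+1))\<^sup>2 - (walk w (2*n))\<^sup>2) / (2*n * ln (2*n)))
       then PlayerB
     else if series_infinite 2 (\<lambda>n. ((walk w (2*n))\<^sup>2 - (walk w (2*n-1))\<^sup>2) / ((2*n-1) * ln (2*n-1)))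
       then PlayerA
     else PlayerA)"

end

theory Submission
  imports Defs "HOL-Real_Asymp.Real_Asymp"
begin

text \<open>Let \<open>p\<close> be the honest player. The claim is that almost surely a surviving sequence is not blamed
  on \<open>p\<close>, and everything probabilistic comes from one source: Ville's maximal inequality for
  nonnegative processes that do not increase on average when \<open>p\<close> tosses the fair coin and do not
  increase at all when the opponent moves (\<open>ville_inequality\<close>). Such a bound holds against every
  strategy of the opponent. It has three consequences.

  First, the moves of \<open>p\<close> form a simple random walk, so their partial sums are eventually below
  \<open>\<epsilon> \<surd>n log log n\<close>; an exponential supermartingale and Borel-Cantelli along powers of two suffice
  (\<open>AE_limsup_own_sum\<close>). Second, a predictable transform of the moves of \<open>p\<close> with square-summable
  coefficients converges (\<open>AE_convergent_transform\<close>); this settles the series with weights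
  \<open>1 / (\<surd>n (log n)\<^sup>3\<^sup>/\<^sup>4)\<close> (\<open>AE_weighted_own_series\<close>). Hence \<open>p\<close> is not blamed in the first two steps.
  Third, suppose that both players pass the first step, so that the position \<open>s\<^sub>k\<close> of the walk, being
  positive, is eventually at most \<open>\<surd>k (log k)\<^sup>1\<^sup>/\<^sup>4\<close> in absolute value. When \<open>p\<close> makes the move \<open>x\<close> from
  \<open>s\<^sub>k\<close>, the square of the position grows by \<open>1 + 2 s\<^sub>k x\<close>. With the weights \<open>1 / (k log k)\<close> the terms
  \<open>1\<close> add up to infinity while the terms \<open>2 s\<^sub>k x\<close> form a convergent transform, so the third-step
  series over the moves of \<open>p\<close> is infinite (\<open>AE_own_increments_at_top\<close>).

  If \<open>p\<close> is A, the third step therefore blames B. If \<open>p\<close> is B, it remains to see that the series over the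
  moves of A cannot be infinite as well. This is deterministic (\<open>not_both_series_infinite\<close>). The two
  series add up to the sum of \<open>(s\<^sub>k\<^sub>+\<^sub>1\<^sup>2 - s\<^sub>k\<^sup>2) / (k log k)\<close>, which after summation by parts is
  controlled by the sum of \<open>s\<^sub>k\<^sup>2 / (k\<^sup>2 log k)\<close>. The second step says that the increments of the walk,
  weighted by \<open>1 / (\<surd>n (log n)\<^sup>3\<^sup>/\<^sup>4)\<close>, have a convergent sum; another summation by parts, together with
  the positivity of the walk, yields that \<open>s\<^sub>k / (k\<^sup>3\<^sup>/\<^sup>2 (log k)\<^sup>3\<^sup>/\<^sup>4)\<close> is summable. Multiplying by the
  bound \<open>\<surd>k (log k)\<^sup>1\<^sup>/\<^sup>4\<close> on the other factor \<open>s\<^sub>k\<close> shows that \<open>s\<^sub>k\<^sup>2 / (k\<^sup>2 log k)\<close> is summable, so the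
  total is bounded above.\<close>

section \<open>Cylinders and functions of finitely many moves\<close>

text \<open>Indices of terms start at 0 here, so that A owns the even ones; the term of index \<open>k\<close> is the one
  chosen after a history of length \<open>k\<close>.\<close>

definition moves :: "player \<Rightarrow> nat \<Rightarrow> bool" where
  "moves p k \<longleftrightarrow> p = (if even k then PlayerA else PlayerB)"

lemma mover_eq_iff: "mover h = p \<longleftrightarrow> moves p (length h)"
  by (auto simp: mover_def moves_def)

definition prefix_determined :: "nat \<Rightarrow> ((nat \<Rightarrow> int) \<Rightarrow> 'a) \<Rightarrow> bool" where
  "prefix_determined n f \<longleftrightarrow> (\<forall>w w'. (\<forall>i<n. w i = w' i) \<longrightarrow> f w = f w')"

lemma prefix_determinedD:
  "prefix_determined n f \<Longrightarrow> (\<And>i. i < n \<Longrightarrow> w i = w' i) \<Longrightarrow> f w = f w'"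
  by (simp add: prefix_determined_def)

lemma prefix_determined_upd:
  "prefix_determined n f \<Longrightarrow> n \<le> k \<Longrightarrow> f (w(k := x)) = f w"
  by (erule prefix_determinedD) auto

lemma prefix_determined_sum:
  assumes "\<And>k. k \<in> I \<Longrightarrow> prefix_determined n (f k)"
  shows "prefix_determined n (\<lambda>w. \<Sum>k\<in>I. f k w)"
  unfolding prefix_determined_def
  by (intro allI impI sum.cong refl) (use assms in \<open>auto simp: prefix_determined_def\<close>)

definition cyl :: "nat \<Rightarrow> (nat \<Rightarrow> int) \<Rightarrow> (nat \<Rightarrow> int) set" where
  "cyl n w = {v. \<forall>i<n. v i = w i}"

lemma measurable_play_law_coord [measurable]:
  "(\<lambda>w. w i) \<in> play_law S \<rightarrow>\<^sub>M count_space UNIV"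
  using measurable_component_singleton[of i UNIV "\<lambda>_. count_space (UNIV :: int set)"]
  by (simp add: measurable_cong_sets[OF sets_play_law refl])

lemma sets_cyl [measurable]: "cyl n w \<in> sets (play_law S)"
proof -
  have "cyl n w = {v \<in> space (play_law S). \<forall>i<n. v i = w i}"
    by (simp add: cyl_def space_play_law)
  also have "\<dots> \<in> sets (play_law S)" by measurable
  finally show ?thesis .
qed

text \<open>Such a function factors through the countable set of histories of length \<open>n\<close>, hence it is
  measurable whatever its codomain.\<close>

lemma measurable_prefix_determined:
  assumes "prefix_determined n f"
  shows "f \<in> play_law S \<rightarrow>\<^sub>M count_space UNIV"
proof -
  have pre: "(\<lambda>w. map w [0..<n]) \<in> play_law S \<rightarrow>\<^sub>M count_space UNIV"
  proof (rule measurable_count_space_eq2_countable[THEN iffD2], intro conjI ballI)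
    fix h :: "int list"
    have "(\<lambda>w. map w [0..<n]) -` {h} \<inter> space (play_law S)
        = (if length h = n then cyl n (\<lambda>i. h ! i) else {})"
    proof (cases "length h = n")
      case True
      then have "map w [0..<n] = h \<longleftrightarrow> (\<forall>i<n. w i = h ! i)" for w
        by (simp add: list_eq_iff_nth_eq)
      with True show ?thesis by (auto simp: cyl_def space_play_law)
    qed auto
    then show "(\<lambda>w. map w [0..<n]) -` {h} \<inter> space (play_law S) \<in> sets (play_law S)"
      by (simp add: sets_cyl)
  qed simp_all
  have eq: "f (\<lambda>i. map w [0..<n] ! i) = f w" for w
    by (rule prefix_determinedD[OF assms]) simp
  have "(\<lambda>w. f (\<lambda>i. map w [0..<n] ! i)) \<in> play_law S \<rightarrow>\<^sub>M count_space UNIV"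
    by (rule measurable_compose[OF pre, where g = "\<lambda>h. f (\<lambda>i. h ! i)"]) simp
  then show ?thesis by (simp only: eq)
qed

lemma measure_cyl_Suc:
  "measure (play_law S) (cyl (Suc n) (w(n := x))) =
     measure (play_law S) (cyl n w) * pmf (next_move S (map w [0..<n])) x"
proof -
  have 1: "measure (play_law S) (cyl n v) =
      (\<Prod>k<n. pmf (next_move S (map v [0..<k])) (v k))" for n v
  proof -
    have "cyl n v = {u. \<forall>k<length (map v [0..<n]). u k = map v [0..<n] ! k}"
      by (auto simp: cyl_def)
    then have "measure (play_law S) (cyl n v) =
        (\<Prod>k<n. pmf (next_move S (take k (map v [0..<n]))) (map v [0..<n] ! k))"
      by (simp only: measure_play_law_cylinder) simp
    also have "\<dots> = (\<Prod>k<n. pmf (next_move S (map v [0..<k])) (v k))"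
      by (intro prod.cong) (auto simp: take_map)
    finally show ?thesis .
  qed
  have "map (w(n := x)) [0..<k] = map w [0..<k]" if "k \<le> n" for k
    using that by auto
  then show ?thesis by (simp add: 1)
qed

section \<open>Supermartingales against an arbitrary opponent\<close>

text \<open>The conditions mention no strategy: at the turns of \<open>p\<close> the average over a fair coin does not
  increase, and at the other turns no choice of the opponent increases the value. A process of this
  kind is a supermartingale for the play law of every strategy of the opponent.\<close>

definition honest_supermartingale :: "player \<Rightarrow> (nat \<Rightarrow> (nat \<Rightarrow> int) \<Rightarrow> real) \<Rightarrow> bool" where
  "honest_supermartingale p Z \<longleftrightarrow>
     (\<forall>n. prefix_determined n (Z n)) \<and> (\<forall>n w. 0 \<le> Z n w) \<and>
     (\<forall>n w. moves p n \<longrightarrow> Z (Suc n) (w(n := 1)) + Z (Suc n) (w(n := -1)) \<le> 2 * Z n w) \<and>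
     (\<forall>n w x. \<not> moves p n \<longrightarrow> Z (Suc n) (w(n := x)) \<le> Z n w)"

locale honest_play =
  fixes p :: player and S :: "player \<Rightarrow> strategy"
  assumes honest: "S p = honest_strategy"
    and behavior: "behavior_strategy q (S q)"
begin

sublocale prob_space "play_law S"
  by (rule prob_space_play_law)

lemma pmf_next_move_outside:
  assumes "set h \<subseteq> {-1, 1}" "x \<notin> {-1, 1}"
  shows "pmf (next_move S h) x = 0"
  using behavior[of "mover h"] assms
  by (auto simp: behavior_strategy_def next_move_def set_pmf_eq subset_iff)

lemma pmf_next_move_honest:
  assumes "moves p (length h)" "x \<in> {-1, 1}"
  shows "pmf (next_move S h) x = 1 / 2"
proof -
  have "mover h = p" using assms by (simp add: mover_eq_iff)
  then show ?thesis
    using assms(2) by (auto simp: next_move_def honest honest_strategy_def)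
qed

text \<open>A sequence outside \<open>sign_seqs\<close> has a first term outside \<open>{-1, 1}\<close>; it lies in the cylinder given
  by the history up to that term. There are countably many such cylinders, each of probability 0.\<close>

lemma AE_sign_seqs: "AE w in play_law S. w \<in> sign_seqs"
proof -
  have *: "AE w in play_law S. \<not> (\<forall>k<Suc (length h). w k = (h @ [x]) ! k)"
    if "set h \<subseteq> {-1, 1}" "x \<notin> {-1, 1}" for h :: "int list" and x :: int
  proof -
    let ?w = "\<lambda>i. h ! i"
    have "measure (play_law S) (cyl (Suc (length h)) (?w(length h := x))) = 0"
      using pmf_next_move_outside[OF that] by (simp add: measure_cyl_Suc map_nth)
    then have "cyl (Suc (length h)) (?w(length h := x)) \<in> null_sets (play_law S)"
      by (simp add: null_sets_def emeasure_eq_measure)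
    from AE_not_in[OF this] show ?thesis
      by eventually_elim (auto simp: cyl_def nth_append less_Suc_eq split: if_splits)
  qed
  have "AE w in play_law S. \<forall>h\<in>{h. set h \<subseteq> {-1, 1}}. \<forall>x\<in>-{-1, 1}.
      \<not> (\<forall>k<Suc (length h). w k = (h @ [x]) ! k)"
    using * by (subst AE_ball_countable, simp, intro ballI, subst AE_ball_countable) auto
  then show ?thesis
  proof eventually_elim
    case (elim w)
    have "w n \<in> {-1, 1}" for n
    proof (induction n rule: less_induct)
      case (less n)
      have "set (map w [0..<n]) \<subseteq> {-1, 1}" using less by fastforce
      moreover have "\<forall>k<Suc (length (map w [0..<n])). w k = (map w [0..<n] @ [w n]) ! k"
        by (auto simp: nth_append less_Suc_eq)
      ultimately show ?case using elim by blast
    qed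
    then show ?case by (auto simp: sign_seqs_def)
  qed
qed

lemma next_move_sum_le:
  assumes Z: "honest_supermartingale p Z"
  shows "pmf (next_move S (map w [0..<n])) 1 * Z (Suc n) (w(n := 1)) +
         pmf (next_move S (map w [0..<n])) (-1) * Z (Suc n) (w(n := -1)) \<le> Z n w"
proof (cases "moves p n")
  case True
  then have "Z (Suc n) (w(n := 1)) + Z (Suc n) (w(n := -1)) \<le> 2 * Z n w"
    using Z by (auto simp: honest_supermartingale_def)
  then show ?thesis using True by (simp add: pmf_next_move_honest)
next
  case False
  let ?q = "next_move S (map w [0..<n])"
  have le: "Z (Suc n) (w(n := x)) \<le> Z n w" for x
    using Z False by (auto simp: honest_supermartingale_def)
  have "pmf ?q 1 + pmf ?q (-1) = (\<Sum>x\<in>{1, -1}. pmf ?q x)" by simp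
  also have "\<dots> = measure ?q {1, -1}" by (subst measure_measure_pmf_finite) auto
  also have "\<dots> \<le> 1" by simp
  finally have "(pmf ?q 1 + pmf ?q (-1)) * Z n w \<le> 1 * Z n w"
    using Z by (intro mult_right_mono) (auto simp: honest_supermartingale_def)
  moreover have step: "pmf ?q x * Z (Suc n) (w(n := x)) \<le> pmf ?q x * Z n w" for x
    by (intro mult_left_mono le) simp
  ultimately show ?thesis
    using step[of 1] step[of "-1"] unfolding distrib_right by linarith
qed

lemma sets_reach:
  assumes Z: "honest_supermartingale p Z"
  shows "{v. \<exists>m\<in>I. c \<le> Z m v} \<in> sets (play_law S)"
proof -
  have [measurable]: "Measurable.pred (play_law S) (\<lambda>v. c \<le> Z m v)" for m
  proof -
    have det: "prefix_determined m (Z m)"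
      using Z by (simp add: honest_supermartingale_def)
    have "prefix_determined m (\<lambda>v. c \<le> Z m v)"
      unfolding prefix_determined_def by (intro allI impI arg_cong[where f="\<lambda>z. c \<le> z"] prefix_determinedD[OF det]) simp
    then show ?thesis by (rule measurable_prefix_determined)
  qed
  have "{v \<in> space (play_law S). \<exists>m\<in>I. c \<le> Z m v} \<in> sets (play_law S)"
    by measurable
  then show ?thesis by (simp add: space_play_law)
qed

text \<open>Ville's inequality conditional on a history, for a horizon of \<open>d\<close> further moves. Backward
  induction avoids integrals altogether: a cylinder on which the level is not yet reached splits,
  up to a null set, into the two cylinders of the next move.\<close>

lemma ville_on_cylinder:
  assumes Z: "honest_supermartingale p Z" and c: "0 \<le> c"
  shows "c * prob (cyl n w \<inter> {v. \<exists>m\<in>{n..n+d}. c \<le> Z m v}) \<le> prob (cyl n w) * Z n w"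
proof -
  have det: "Z n v = Z n w" if "v \<in> cyl n w" for n v w
  proof -
    have "prefix_determined n (Z n)" using Z by (simp add: honest_supermartingale_def)
    from prefix_determinedD[OF this, of v w] that show ?thesis by (simp add: cyl_def)
  qed
  have not_reached: "\<not> c \<le> Z n v" if "\<not> c \<le> Z n w" "v \<in> cyl n w" for n v w
    using that det[of v n w] by simp
  have nonneg: "0 \<le> Z n w" for n w
    using Z by (simp add: honest_supermartingale_def)
  have reached: "c * prob (cyl n w \<inter> E) \<le> prob (cyl n w) * Z n w" if "c \<le> Z n w" for E n w
  proof -
    have "c * prob (cyl n w \<inter> E) \<le> Z n w * prob (cyl n w)"
      using that nonneg c by (intro mult_mono finite_measure_mono) auto
    then show ?thesis by (simp add: mult.commute)
  qed
  show ?thesis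
  proof (induction d arbitrary: n w)
    case 0
    show ?case
    proof (cases "c \<le> Z n w")
      case False
      then have "cyl n w \<inter> {v. \<exists>m\<in>{n..n+0}. c \<le> Z m v} = {}"
        using not_reached[OF False] by auto
      then show ?thesis using nonneg by simp
    qed (rule reached)
  next
    case (Suc d)
    show ?case
    proof (cases "c \<le> Z n w")
      case False
      let ?E = "{v. \<exists>m\<in>{Suc n..Suc n+d}. c \<le> Z m v}"
      let ?C = "\<lambda>x. cyl (Suc n) (w(n := x))"
      have E: "?E \<in> events" by (rule sets_reach[OF Z])
      have "cyl n w \<inter> {v. \<exists>m\<in>{n..n + Suc d}. c \<le> Z m v} = cyl n w \<inter> ?E"
      proof (intro equalityI subsetI IntI CollectI; elim IntE CollectE bexE)
        fix v m assume v: "v \<in> cyl n w" and m: "m \<in> {n..n + Suc d}" "c \<le> Z m v"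
        then have "m \<noteq> n" using not_reached[OF False v] by metis
        then show "\<exists>m\<in>{Suc n..Suc n + d}. c \<le> Z m v"
          using m by (intro bexI[of _ m]) auto
      next
        fix v m assume "m \<in> {Suc n..Suc n + d}" "c \<le> Z m v"
        then show "\<exists>m\<in>{n..n + Suc d}. c \<le> Z m v"
          by (intro bexI[of _ m]) auto
      qed
      then have "prob (cyl n w \<inter> {v. \<exists>m\<in>{n..n + Suc d}. c \<le> Z m v}) = prob (cyl n w \<inter> ?E)"
        by (simp only:)
      also have "prob (cyl n w \<inter> ?E) \<le> prob ((?C 1 \<inter> ?E) \<union> (?C (-1) \<inter> ?E))"
      proof (rule finite_measure_mono_AE)
        show "AE v in play_law S. v \<in> cyl n w \<inter> ?E \<longrightarrow> v \<in> (?C 1 \<inter> ?E) \<union> (?C (-1) \<inter> ?E)"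
          using AE_sign_seqs
        proof eventually_elim
          case (elim v)
          then have "v n = 1 \<or> v n = -1" by (auto simp: sign_seqs_def)
          then show ?case by (auto simp: cyl_def less_Suc_eq)
        qed
      qed (intro sets.Un sets.Int sets_cyl E)
      also have "\<dots> \<le> prob (?C 1 \<inter> ?E) + prob (?C (-1) \<inter> ?E)"
        by (intro measure_Un_le sets.Int sets_cyl E)
      finally have "c * prob (cyl n w \<inter> {v. \<exists>m\<in>{n..n + Suc d}. c \<le> Z m v})
          \<le> c * (prob (?C 1 \<inter> ?E) + prob (?C (-1) \<inter> ?E))"
        using c by (intro mult_left_mono)
      also have "\<dots> \<le> prob (?C 1) * Z (Suc n) (w(n := 1)) + prob (?C (-1)) * Z (Suc n) (w(n := -1))"
        unfolding distrib_left by (intro add_mono Suc)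
      also have "\<dots> = prob (cyl n w) *
          (pmf (next_move S (map w [0..<n])) 1 * Z (Suc n) (w(n := 1)) +
           pmf (next_move S (map w [0..<n])) (-1) * Z (Suc n) (w(n := -1)))"
        unfolding measure_cyl_Suc by (simp add: distrib_left mult.assoc)
      also have "\<dots> \<le> prob (cyl n w) * Z n w"
        by (intro mult_left_mono next_move_sum_le[OF Z]) simp
      finally show ?thesis .
    qed (rule reached)
  qed
qed

lemma ville_inequality:
  assumes Z: "honest_supermartingale p Z" and c: "0 < c"
  shows "prob {v. \<exists>m. c \<le> Z m v} \<le> Z 0 w / c"
proof -
  let ?E = "\<lambda>d. {v. \<exists>m\<in>{0..0+d}. c \<le> Z m v}"
  have "prob (?E d) \<le> Z 0 w / c" for d
    using ville_on_cylinder[OF Z, of c 0 w d] c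
    by (simp add: cyl_def prob_space[unfolded space_play_law] pos_le_divide_eq mult.commute)
  moreover have "(\<lambda>d. prob (?E d)) \<longlonglongrightarrow> prob (\<Union>d. ?E d)"
  proof (intro finite_Lim_measure_incseq)
    show "range ?E \<subseteq> events"
      using sets_reach[OF Z] by blast
    show "incseq ?E"
      by (intro monoI Collect_mono) fastforce
  qed
  ultimately have "prob (\<Union>d. ?E d) \<le> Z 0 w / c"
    by (intro LIMSEQ_le_const2) auto
  moreover have "(\<Union>d. ?E d) = {v. \<exists>m. c \<le> Z m v}"
  proof (intro equalityI subsetI)
    fix v assume "v \<in> {v. \<exists>m. c \<le> Z m v}"
    then obtain m where "c \<le> Z m v" by blast
    then show "v \<in> (\<Union>d. ?E d)" by (intro UN_I[of m]) auto
  qed blast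
  ultimately show ?thesis by simp
qed

text \<open>The martingale convergence theorem in the case of deterministic bounds on the increments. For each
  starting time \<open>m\<close>, the square of the sum since time \<open>m\<close> plus the tail \<open>T\<close> of the sum of the \<open>c\<^sub>k\<^sup>2\<close> is
  a nonnegative supermartingale with initial value \<open>T m\<close>. By Ville's inequality the sums ever
  deviate by \<open>e\<close> or more from their value at time \<open>m\<close> with probability at most \<open>T m / e\<^sup>2\<close>, which tends to 0.\<close>

lemma AE_convergent_transform:
  fixes F :: "nat \<Rightarrow> (nat \<Rightarrow> int) \<Rightarrow> real" and c :: "nat \<Rightarrow> real"
  assumes det: "\<And>k. prefix_determined k (F k)"
    and bound: "\<And>k w. \<bar>F k w\<bar> \<le> c k"
    and honest_turns: "\<And>k w. \<not> moves p k \<Longrightarrow> F k w = 0"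
    and square_summable: "summable (\<lambda>k. (c k)\<^sup>2)"
  shows "AE w in play_law S. convergent (\<lambda>n. \<Sum>k<n. F k w * real_of_int (w k))"
proof -
  define T where "T n = (\<Sum>k. (c k)\<^sup>2) - (\<Sum>k<n. (c k)\<^sup>2)" for n
  define X where "X m n w = (\<Sum>k\<in>{m..<n}. F k w * real_of_int (w k))" for m n w
  define Z where "Z m n w = (X m n w)\<^sup>2 + T (max m n)" for m n w
  have T_nonneg: "0 \<le> T n" for n
    unfolding T_def using sum_le_suminf[OF square_summable, of "{..<n}"] by simp
  have T_Suc: "T n = (c n)\<^sup>2 + T (Suc n)" for n
    by (simp add: T_def)
  have T_lim: "T \<longlonglongrightarrow> 0"
    using tendsto_diff[OF tendsto_const[of "\<Sum>k. (c k)\<^sup>2"] summable_LIMSEQ[OF square_summable]]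
    by (simp add: T_def[abs_def])
  have X_upd: "X m (Suc n) (w(n := x)) = X m n w + F n w * real_of_int x" if "m \<le> n" for m n w x
  proof -
    have "X m n (w(n := x)) = X m n w"
      unfolding X_def by (intro sum.cong refl) (simp add: prefix_determined_upd[OF det])
    moreover have "X m (Suc n) v = X m n v + F n v * real_of_int (v n)" for v
      unfolding X_def using that by simp
    ultimately show ?thesis by (simp add: prefix_determined_upd[OF det])
  qed
  have X_empty: "X m n w = 0" if "n \<le> m" for m n w
    using that by (simp add: X_def)
  \<comment> \<open>Before time \<open>m\<close> the process is constant. At a turn of \<open>p\<close> the fair coin raises the square by
    \<open>(F n w)\<^sup>2\<close> on average, which the decrease \<open>(c n)\<^sup>2\<close> of the tail compensates.\<close>
  have Z: "honest_supermartingale p (Z m)" for m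
    unfolding honest_supermartingale_def
  proof (intro conjI allI impI)
    fix n w
    show "0 \<le> Z m n w" by (simp add: Z_def T_nonneg)
    have "prefix_determined n (X m n)"
      unfolding X_def
    proof (rule prefix_determined_sum)
      fix k assume "k \<in> {m..<n}"
      then show "prefix_determined n (\<lambda>w. F k w * real_of_int (w k))"
        unfolding prefix_determined_def
        using prefix_determinedD[OF det[of k]] by (metis atLeastLessThan_iff order.strict_trans)
    qed
    then show "prefix_determined n (Z m n)"
      unfolding prefix_determined_def Z_def by metis
    show "Z m (Suc n) (w(n := 1)) + Z m (Suc n) (w(n := -1)) \<le> 2 * Z m n w"
    proof (cases "m \<le> n")
      case True
      have "(F n w)\<^sup>2 \<le> (c n)\<^sup>2"
        using bound[of n w] by (simp add: abs_le_square_iff[symmetric])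
      then show ?thesis
        using True T_Suc[of n] by (simp add: Z_def X_upd power2_eq_square algebra_simps)
    qed (simp add: Z_def X_empty)
    fix x assume "\<not> moves p n"
    then show "Z m (Suc n) (w(n := x)) \<le> Z m n w"
    proof (cases "m \<le> n")
      case True
      with \<open>\<not> moves p n\<close> show ?thesis
        using T_Suc[of n] honest_turns[of n w] by (simp add: Z_def X_upd)
    qed (simp add: Z_def X_empty)
  qed
  have "AE w in play_law S. \<exists>m. \<forall>n. \<bar>X m n w\<bar> < e" if "0 < e" for e :: real
  proof -
    let ?R = "\<lambda>m. {v. \<exists>n. e\<^sup>2 \<le> Z m n v}"
    have R: "?R m \<in> events" for m
      using sets_reach[OF Z, of UNIV "e\<^sup>2" m] by simp
    have "prob (\<Inter>m. ?R m) \<le> T m / e\<^sup>2" for m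
    proof -
      have "prob (\<Inter>m. ?R m) \<le> prob (?R m)"
        by (intro finite_measure_mono R) blast
      also have "\<dots> \<le> T m / e\<^sup>2"
        using ville_inequality[OF Z, of "e\<^sup>2" m] that by (simp add: Z_def X_empty)
      finally show ?thesis .
    qed
    moreover have "(\<lambda>m. T m / e\<^sup>2) \<longlonglongrightarrow> 0"
      using tendsto_divide[OF T_lim tendsto_const[of "e\<^sup>2"]] that by simp
    ultimately have "prob (\<Inter>m. ?R m) \<le> 0"
      by (intro LIMSEQ_le_const) auto
    then have "(\<Inter>m. ?R m) \<in> null_sets (play_law S)"
      using R by (auto simp: null_sets_def emeasure_eq_measure measure_le_0_iff intro!: sets.countable_INT)
    from AE_not_in[OF this] show ?thesis
    proof eventually_elim
      case (elim w)
      then obtain m where m: "\<And>n. Z m n w < e\<^sup>2" by (auto simp: not_le)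
      have "(X m n w)\<^sup>2 < e\<^sup>2" for n
        using m[of n] T_nonneg[of "max m n"] by (simp add: Z_def)
      then have "\<bar>X m n w\<bar> < e" for n
        using that power_mono[of e "\<bar>X m n w\<bar>" 2] by (force simp: not_le[symmetric])
      then show ?case by blast
    qed
  qed
  then have "AE w in play_law S. \<forall>j. \<exists>m. \<forall>n. \<bar>X m n w\<bar> < inverse (real (Suc j))"
    by (simp add: AE_all_countable)
  then show ?thesis
  proof eventually_elim
    case (elim w)
    let ?S = "\<lambda>n. \<Sum>k<n. F k w * real_of_int (w k)"
    have split: "?S n = ?S m + X m n w" if "m \<le> n" for m n
      unfolding X_def using that sum.atLeastLessThan_concat[of 0 m n "\<lambda>k. F k w * real_of_int (w k)"]
      by (simp add: atLeast0LessThan)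
    have "Cauchy ?S"
    proof (rule metric_CauchyI)
      fix e :: real assume "0 < e"
      then obtain j where j: "inverse (real (Suc j)) < e / 2"
        using reals_Archimedean[of "e / 2"] by auto
      from elim obtain m where m: "\<And>n. \<bar>X m n w\<bar> < inverse (real (Suc j))" by blast
      have "dist (?S n) (?S n') < e" if "n \<ge> m" "n' \<ge> m" for n n'
        using split[OF that(1)] split[OF that(2)] m[of n] m[of n'] j
        by (simp add: dist_real_def)
      then show "\<exists>M. \<forall>m\<ge>M. \<forall>n\<ge>M. dist (?S m) (?S n) < e" by blast
    qed
    then show ?case by (simp add: Cauchy_convergent_iff)
  qed
qed

end

section \<open>The weights of the series\<close>

definition weight :: "real \<Rightarrow> real" where
  "weight x = 1 / (sqrt x * ln x powr (3/4))"

lemma weight_antimono: "1 < x \<Longrightarrow> x \<le> y \<Longrightarrow> weight y \<le> weight x"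
  unfolding weight_def
  by (intro divide_left_mono mult_mono powr_mono2) (auto intro!: mult_pos_pos ln_gt_zero)

text \<open>The squares are \<open>1 / (n (log n)\<^sup>3\<^sup>/\<^sup>2)\<close>, of the order of the differences of \<open>(log n)\<^sup>-\<^sup>1\<^sup>/\<^sup>2\<close>,
  which telescope.\<close>

lemma summable_weight: "summable (\<lambda>n. (weight (real n))\<^sup>2)"
proof (rule summable_comparison_test_bigo)
  have "summable (\<lambda>n. ln (real n) powr (-1/2) - ln (real (Suc n)) powr (-1/2))"
    by (rule telescope_summable') real_asymp
  moreover have "eventually (\<lambda>n::nat. ln (real n) powr (-1/2) - ln (real (Suc n)) powr (-1/2) \<ge> 0) sequentially"
    by real_asymp
  ultimately show "summable (\<lambda>n. norm (ln (real n) powr (-1/2) - ln (real (Suc n)) powr (-1/2)))"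
    by (subst summable_cong[of _ "\<lambda>n. ln (real n) powr (-1/2) - ln (real (Suc n)) powr (-1/2)"])
      (auto elim!: eventually_mono)
  show "(\<lambda>n. (weight (real n))\<^sup>2) \<in> O(\<lambda>n. ln (real n) powr (-1/2) - ln (real (Suc n)) powr (-1/2))"
    unfolding weight_def by real_asymp
qed

text \<open>The term of index \<open>k\<close> is played in round \<open>k div 2 + 1\<close>; in this form the weights of the rounds serve
  as coefficients for a sum over all terms.\<close>

lemma summable_weight_round: "summable (\<lambda>k. (weight (real (k div 2 + 1)))\<^sup>2)"
proof (rule summable_comparison_test_bigo)
  show "summable (\<lambda>k. norm ((weight (real k))\<^sup>2))"
    using summable_weight by simp
  have "eventually (\<lambda>k. norm ((weight (real (k div 2 + 1)))\<^sup>2) \<le> (weight ((real k + 1) / 2))\<^sup>2) sequentially"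
    using eventually_ge_at_top[of 2]
  proof eventually_elim
    case (elim k)
    \<comment> \<open>Replacing the integer quotient by a real one lets asymptotic expansion finish the comparison.\<close>
    have "k + 1 \<le> 2 * (k div 2 + 1)" by simp
    then have "real (k + 1) \<le> real (2 * (k div 2 + 1))" by (rule of_nat_mono)
    then have le: "(real k + 1) / 2 \<le> real (k div 2 + 1)" by simp
    have "weight (real (k div 2 + 1)) \<le> weight ((real k + 1) / 2)"
      using elim le by (intro weight_antimono) auto
    moreover have "0 \<le> weight (real (k div 2 + 1))"
      by (simp add: weight_def)
    ultimately show ?case by (simp add: power_mono)
  qed
  then have "(\<lambda>k. (weight (real (k div 2 + 1)))\<^sup>2) \<in> O(\<lambda>k. (weight ((real k + 1) / 2))\<^sup>2)"
    by (intro bigoI[of _ 1]) simp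
  also have "(\<lambda>k. (weight ((real k + 1) / 2))\<^sup>2) \<in> O(\<lambda>k. (weight (real k))\<^sup>2)"
    unfolding weight_def by real_asymp
  finally show "(\<lambda>k. (weight (real (k div 2 + 1)))\<^sup>2) \<in> O(\<lambda>k. (weight (real k))\<^sup>2)" .
qed

text \<open>The terms dominate, up to a constant, the differences of \<open>log log k\<close>.\<close>

lemma not_summable_recip_log: "\<not> summable (\<lambda>k::nat. 1 / (real (2*k+r) * ln (real (2*k+r))))"
  if "r \<le> 2" for r :: nat
proof
  let ?l = "\<lambda>k::nat. ln (ln (real k))"
  assume "summable (\<lambda>k::nat. 1 / (real (2*k+r) * ln (real (2*k+r))))"
  then have s: "summable (\<lambda>k::nat. norm (1 / (real (2*k+r) * ln (real (2*k+r)))))"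
  proof (rule summable_cong[THEN iffD1, rotated])
    show "eventually (\<lambda>k. 1 / (real (2*k+r) * ln (real (2*k+r))) =
        norm (1 / (real (2*k+r) * ln (real (2*k+r))))) sequentially"
      using eventually_ge_at_top[of 1]
    proof eventually_elim
      case (elim k)
      then have "0 \<le> ln (real (2*k+r))" by (intro ln_ge_zero) auto
      then show ?case by simp
    qed
  qed
  have "(\<lambda>k. ?l (Suc k) - ?l k) \<in> O(\<lambda>k::nat. 1 / (real (2*k+r) * ln (real (2*k+r))))"
    by real_asymp
  from summable_comparison_test_bigo[OF s this]
  have "convergent (\<lambda>n. \<Sum>k<n. ?l (Suc k) - ?l k)"
    by (simp add: summable_iff_convergent)
  then have "convergent (\<lambda>n. ?l n - ?l 0)"
    by (subst (asm) sum_lessThan_telescope)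
  then obtain L where "(\<lambda>n. ?l n - ?l 0) \<longlonglongrightarrow> L" by (auto simp: convergent_def)
  moreover have "filterlim (\<lambda>n. ?l n - ?l 0) at_top sequentially"
    by real_asymp
  ultimately show False
    by (metis not_tendsto_and_filterlim_at_infinity filterlim_at_top_imp_at_infinity sequentially_bot)
qed

lemma bound_sqrt_loglog:
  "eventually (\<lambda>k::nat. 2 + 2 * (sqrt (real k) * ln (ln (real k))) \<le> sqrt (real k) * ln (real k) powr (1/4)) sequentially"
  by real_asymp

text \<open>The inequality behind the choice of the exponents: both sides are of order
  \<open>1 / (k\<^sup>3\<^sup>/\<^sup>2 (log k)\<^sup>3\<^sup>/\<^sup>4)\<close>. It lets the sum of \<open>s\<^sub>k\<^sup>2 / (k\<^sup>2 log k)\<close> be compared with the sum of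
  \<open>s\<^sub>k\<close> times the differences of \<open>weight\<close> as soon as one factor \<open>s\<^sub>k\<close> is at most \<open>\<surd>k (log k)\<^sup>1\<^sup>/\<^sup>4\<close>.\<close>

lemma drift_weight_comparison:
  "\<exists>C\<ge>0. eventually (\<lambda>k. sqrt (real k) * ln (real k) powr (1/4) *
      (1 / (real (k - 1) * ln (real (k - 1))) - 1 / (real k * ln (real k)))
    \<le> C * (weight (real (k div 2)) - weight (real (Suc (k div 2))))) sequentially"
proof -
  let ?g = "\<lambda>k. 1 / (real k * ln (real k))"
  let ?l = "\<lambda>k. sqrt (real k) * ln (real k) powr (1/4) * (?g (k - 1) - ?g k)"
  let ?d = "\<lambda>n::nat. weight (real n) - weight (real (Suc n))"
  have "(\<lambda>n. ?l (2 * n)) \<in> O(?d)" "(\<lambda>n. ?l (Suc (2 * n))) \<in> O(?d)"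
    unfolding weight_def by real_asymp+
  then obtain C1 C2 where C: "0 < C1" "0 < C2"
    "eventually (\<lambda>n. norm (?l (2 * n)) \<le> C1 * norm (?d n)) sequentially"
    "eventually (\<lambda>n. norm (?l (Suc (2 * n))) \<le> C2 * norm (?d n)) sequentially"
    by (elim landau_o.bigE) blast
  have half: "filterlim (\<lambda>k::nat. k div 2) sequentially sequentially"
    by (rule filterlim_at_top_div_const_nat) simp
  have "eventually (\<lambda>n. ?l (2 * n) \<le> (C1 + C2) * ?d n \<and> ?l (Suc (2 * n)) \<le> (C1 + C2) * ?d n) sequentially"
    using C(3,4) eventually_ge_at_top[of 2]
  proof eventually_elim
    case (elim n)
    have d: "0 \<le> ?d n" using weight_antimono[of "real n" "real (Suc n)"] elim by simp
    then have "C1 * ?d n \<le> (C1 + C2) * ?d n" "C2 * ?d n \<le> (C1 + C2) * ?d n"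
      using C(1,2) by (auto intro!: mult_right_mono)
    with elim d show ?case by (smt (verit, best) real_norm_def)
  qed
  from eventually_compose_filterlim[OF this half]
  have "eventually (\<lambda>k. ?l k \<le> (C1 + C2) * ?d (k div 2)) sequentially"
  proof eventually_elim
    case (elim k)
    have "k = 2 * (k div 2) \<or> k = Suc (2 * (k div 2))" by presburger
    with elim show ?case by metis
  qed
  then show ?thesis using C(1,2) by (intro exI[of _ "C1 + C2"]) auto
qed

section \<open>The walk and the moves of one player\<close>

definition own_move :: "player \<Rightarrow> (nat \<Rightarrow> int) \<Rightarrow> nat \<Rightarrow> int" where
  "own_move p w n = (case p of PlayerA \<Rightarrow> move_A w n | PlayerB \<Rightarrow> move_B w n)"

definition own_sum :: "player \<Rightarrow> (nat \<Rightarrow> int) \<Rightarrow> nat \<Rightarrow> int" where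
  "own_sum p w n = (\<Sum>i=1..n. own_move p w i)"

text \<open>The index, counted from 0, of the \<open>n\<close>-th move of the player, where rounds are counted from 1.\<close>

definition own_index :: "player \<Rightarrow> nat \<Rightarrow> nat" where
  "own_index p n = (case p of PlayerA \<Rightarrow> 2 * n - 2 | PlayerB \<Rightarrow> 2 * n - 1)"

lemma own_move_eq: "1 \<le> n \<Longrightarrow> own_move p w n = w (own_index p n)"
  by (cases p) (auto simp: own_move_def own_index_def move_A_def move_B_def term_at_def numeral_2_eq_2)

lemma own_sum_simps:
  "own_sum PlayerA w n = sum_A w n" "own_sum PlayerB w n = sum_B w n"
  by (simp_all add: own_sum_def own_move_def sum_A_def sum_B_def)

lemma sum_own_turns:
  fixes g :: "nat \<Rightarrow> 'a :: comm_monoid_add"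
  shows "(\<Sum>k<2*N. if moves p k then g k else 0) = (\<Sum>n=1..N. g (own_index p n))"
proof (induction N)
  case (Suc N)
  have "(\<Sum>k<2 * Suc N. if moves p k then g k else 0) =
      (\<Sum>k<2*N. if moves p k then g k else 0) +
      ((if moves p (2*N) then g (2*N) else 0) + (if moves p (Suc (2*N)) then g (Suc (2*N)) else 0))"
    by (simp add: add.assoc)
  also have "(if moves p (2*N) then g (2*N) else 0) + (if moves p (Suc (2*N)) then g (Suc (2*N)) else 0)
      = g (own_index p (Suc N))"
    by (cases p) (auto simp: moves_def own_index_def)
  finally show ?case by (simp add: Suc)
qed simp

lemma walk_eq: "walk w n = 1 + (\<Sum>i<n. w i)"
proof -
  have "(\<Sum>i=1..n. term_at w i) = (\<Sum>i<n. w i)"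
    by (rule sum.reindex_bij_witness[of _ Suc "\<lambda>i. i - 1"]) (auto simp: term_at_def)
  then show ?thesis by (simp add: walk_def)
qed

lemma walk_Suc: "walk w (Suc n) = walk w n + w n"
  by (simp add: walk_eq)

lemma walk_even_eq: "walk w (2 * n) = 1 + own_sum PlayerA w n + own_sum PlayerB w n"
proof (induction n)
  case 0
  then show ?case by (simp add: walk_eq own_sum_def)
next
  case (Suc n)
  then show ?case
    by (simp add: walk_Suc own_sum_def own_move_eq own_index_def)
qed

text \<open>The walk starts at 1, has steps \<open>1\<close> and \<open>-1\<close>, and never visits 0.\<close>

lemma walk_ge_1:
  assumes "w \<in> sign_seqs - D_set"
  shows "1 \<le> walk w n"
proof (induction n)
  case (Suc n)
  have "w n \<in> {-1, 1}" using assms by (auto simp: sign_seqs_def)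
  then have "0 \<le> walk w (Suc n)" using Suc by (auto simp: walk_Suc)
  moreover have "walk w (Suc n) \<noteq> 0"
  proof
    assume "walk w (Suc n) = 0"
    then have "(\<Sum>i=1..Suc n. term_at w i) = -1" by (simp only: walk_def)
    then have "w \<in> D_set" using assms unfolding D_set_def by force
    then show False using assms by simp
  qed
  ultimately show ?case by linarith
qed (simp add: walk_eq)

lemma walk_le_walk_even:
  assumes "w \<in> sign_seqs"
  shows "walk w k \<le> walk w (2 * (k div 2)) + 1"
proof (cases "even k")
  case False
  then have "k = Suc (2 * (k div 2))" by simp
  then have "walk w k = walk w (2 * (k div 2)) + w (2 * (k div 2))" by (metis walk_Suc)
  moreover have "w (2 * (k div 2)) \<in> {-1, 1}" using assms by (auto simp: sign_seqs_def)
  ultimately show ?thesis by auto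
qed simp

lemma limsup_nonpos_imp_eventually_le:
  assumes "\<not> 0 < limsup (\<lambda>n. ereal (real_of_int (s n) / (sqrt (real n) * ln (ln (real n)))))"
  shows "eventually (\<lambda>n. real_of_int (s n) \<le> sqrt (real n) * ln (ln (real n))) sequentially"
proof -
  have "limsup (\<lambda>n. ereal (real_of_int (s n) / (sqrt (real n) * ln (ln (real n))))) < 1"
    using assms le_less_trans[of "limsup (\<lambda>n. ereal (real_of_int (s n) / (sqrt (real n) * ln (ln (real n)))))" 0 1]
    by (simp only: not_less) simp
  then have "eventually (\<lambda>n. ereal (real_of_int (s n) / (sqrt (real n) * ln (ln (real n)))) < 1) sequentially"
    by (rule Limsup_lessD)
  moreover have "eventually (\<lambda>n::nat. 0 < sqrt (real n) * ln (ln (real n))) sequentially"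
    by real_asymp
  ultimately show ?thesis
    by eventually_elim (simp only: one_ereal_def less_ereal.simps pos_divide_less_eq mult_1 less_imp_le)
qed

text \<open>Positivity of the walk makes the upper bounds on the two partial sums a bound on the absolute
  value, and \<open>log log k\<close> is eventually below any positive multiple of \<open>(log k)\<^sup>1\<^sup>/\<^sup>4\<close>.\<close>

lemma eventually_walk_le:
  assumes w: "w \<in> sign_seqs - D_set"
    and A: "\<not> 0 < limsup (\<lambda>n. ereal (sum_A w n / (sqrt n * ln (ln n))))"
    and B: "\<not> 0 < limsup (\<lambda>n. ereal (sum_B w n / (sqrt n * ln (ln n))))"
  shows "eventually (\<lambda>k. \<bar>real_of_int (walk w k)\<bar> \<le> sqrt (real k) * ln (real k) powr (1/4)) sequentially"
proof -
  have half: "filterlim (\<lambda>k::nat. k div 2) sequentially sequentially"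
    by (rule filterlim_at_top_div_const_nat) simp
  have "eventually (\<lambda>n. real_of_int (walk w (2 * n)) \<le> 1 + 2 * (sqrt (real n) * ln (ln (real n)))) sequentially"
    using limsup_nonpos_imp_eventually_le[OF A] limsup_nonpos_imp_eventually_le[OF B]
    by eventually_elim (simp add: walk_even_eq own_sum_simps)
  moreover have "eventually (\<lambda>n. 3 \<le> n) sequentially" by (rule eventually_ge_at_top)
  ultimately have "eventually (\<lambda>n. 3 \<le> n \<and> real_of_int (walk w (2 * n)) \<le> 1 + 2 * (sqrt (real n) * ln (ln (real n)))) sequentially"
    by eventually_elim simp
  from eventually_compose_filterlim[OF this half] bound_sqrt_loglog
  show ?thesis
  proof eventually_elim
    case (elim k)
    define n where "n = k div 2"
    have n: "3 \<le> n" "n \<le> k" using elim by (auto simp: n_def)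
    have "ln 3 \<le> ln (real n)" using n by (intro ln_mono) auto
    moreover have "1 < ln (3::real)" by (simp add: ln3_gt_1)
    ultimately have "1 < ln (real n)" by linarith
    have le: "walk w k \<le> walk w (2 * n) + 1"
      unfolding n_def using walk_le_walk_even w by blast
    have "sqrt (real n) * ln (ln (real n)) \<le> sqrt (real k) * ln (ln (real k))"
      using n \<open>1 < ln (real n)\<close> by (intro mult_mono ln_mono) (auto simp: less_trans[OF zero_less_one] ln_ge_zero)
    moreover have "real_of_int (walk w k) \<le> real_of_int (walk w (2 * n)) + 1"
      using le by linarith
    ultimately have "real_of_int (walk w k) \<le> sqrt (real k) * ln (real k) powr (1/4)"
      using elim by (simp add: n_def)
    moreover have "1 \<le> walk w k" by (rule walk_ge_1[OF w])
    ultimately show ?case by simp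
  qed
qed

section \<open>The partial sums of the honest player\<close>

text \<open>Hoeffding's lemma for a fair sign.\<close>

lemma cosh_le_exp_half_square: "cosh x \<le> exp (x\<^sup>2 / 2)" for x :: real
proof -
  have pos: "cosh y \<le> exp (y\<^sup>2 / 2)" if "0 \<le> y" for y :: real
  proof -
    have "cosh y = exp (- y) * ((1 + exp (2 * y)) / 2)"
      by (simp add: cosh_def field_simps flip: exp_add)
    also have "\<dots> = exp (- y + ln ((1 + exp (2 * y)) / 2))"
      by (subst exp_add, subst exp_ln) (auto intro: add_pos_pos)
    also have "\<dots> \<le> exp (y\<^sup>2 / 2)"
      using Hoeffdings_lemma_aux[of "2 * y" "1/2"] that
      by (simp add: field_simps power2_eq_square)
    finally show ?thesis .
  qed
  show ?thesis
    using pos[of x] pos[of "- x"] by (cases "0 \<le> x") auto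
qed

text \<open>With the parameter \<open>l = 3 / (d \<surd>(2\<^sup>j))\<close>, a partial sum \<open>s\<close> of \<open>N\<close> moves that exceeds
  \<open>d \<surd>N log log N\<close> for an \<open>N\<close> between \<open>2\<^sup>j\<close> and \<open>2\<^sup>j\<^sup>+\<^sup>1\<close> makes the exponential supermartingale
  \<open>exp (l s - l\<^sup>2 N / 2)\<close> as large as \<open>j\<^sup>2\<close>: the linear term is at least \<open>3 log log N\<close>, about
  \<open>3 log j\<close>, and the quadratic term is bounded.\<close>

lemma iterated_log_deviation:
  assumes "0 < d"
  shows "eventually (\<lambda>j. \<forall>N s. 2 ^ j \<le> N \<longrightarrow> N < 2 ^ (j + 1) \<longrightarrow> d * (sqrt (real N) * ln (ln (real N))) < s \<longrightarrow>
    (real j)\<^sup>2 \<le> exp (3 / d / sqrt (2 ^ j) * s - (3 / d / sqrt (2 ^ j))\<^sup>2 / 2 * real N)) sequentially"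
proof -
  define t where "t = 3 / d"
  have t: "0 < t" "t * d = 3" using assms by (simp_all add: t_def)
  \<comment> \<open>Since \<open>l d \<surd>(2\<^sup>j) = 3\<close>, the linear term wins over the level \<open>exp (2 log j) = j\<^sup>2\<close> for large \<open>j\<close>.\<close>
  have "eventually (\<lambda>j. 2 * ln (real j) \<le> 3 * ln (real j * ln 2) - t\<^sup>2) sequentially"
    by real_asymp
  moreover have "eventually (\<lambda>j. 1 \<le> real j * ln 2) sequentially"
    by real_asymp
  ultimately show ?thesis
    using eventually_gt_at_top[of 0]
  proof eventually_elim
    case (elim j)
    show ?case
    proof (intro allI impI)
      fix N :: nat and s :: real
      assume N: "2 ^ j \<le> N" "N < 2 ^ (j + 1)" and s: "d * (sqrt (real N) * ln (ln (real N))) < s"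
      define r where "r = sqrt (2 ^ j :: real)"
      have r: "0 < r" "r\<^sup>2 = 2 ^ j" by (simp_all add: r_def)
      have N': "(2::real) ^ j \<le> real N" "real N \<le> 2 * 2 ^ j"
        using N by (metis of_nat_le_iff of_nat_numeral of_nat_power, metis N(2) less_imp_le of_nat_le_iff of_nat_numeral of_nat_power of_nat_mult power_Suc Suc_eq_plus1)
      have "real j * ln 2 = ln (2 ^ j)" by (simp add: ln_realpow)
      also have "\<dots> \<le> ln (real N)" using N'(1) by (intro ln_mono) (auto intro: less_le_trans[OF _ N'(1)])
      finally have lnN: "real j * ln 2 \<le> ln (real N)" .
      then have lnlnN: "ln (real j * ln 2) \<le> ln (ln (real N))"
        using elim by (intro ln_mono) auto
      have "0 \<le> ln (ln (real N))" using lnN elim by (intro ln_ge_zero) auto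
      have "r \<le> sqrt (real N)" using N'(1) by (simp add: r_def)
      then have "3 * ln (ln (real N)) * r \<le> 3 * ln (ln (real N)) * sqrt (real N)"
        using \<open>0 \<le> ln (ln (real N))\<close> by (intro mult_left_mono) auto
      also have "\<dots> = t * (d * (sqrt (real N) * ln (ln (real N))))"
        using t(2) by (simp add: mult.assoc[symmetric])
      also have "\<dots> \<le> t * s" using s t by (intro mult_left_mono) auto
      finally have "3 * ln (ln (real N)) \<le> t / r * s"
        using r(1) by (simp add: field_simps)
      moreover have "(t / r)\<^sup>2 / 2 * real N \<le> t\<^sup>2"
        using N'(2) r(1) t(1) by (simp add: power_divide r(2) field_simps)
      ultimately have "2 * ln (real j) \<le> t / r * s - (t / r)\<^sup>2 / 2 * real N"
        using elim lnlnN by linarith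
      then have "exp (2 * ln (real j)) \<le> exp (t / r * s - (t / r)\<^sup>2 / 2 * real N)" by simp
      moreover have "exp (2 * ln (real j)) = (real j)\<^sup>2"
        using elim by (simp add: exp_double)
      ultimately show "(real j)\<^sup>2 \<le> exp (3 / d / sqrt (2 ^ j) * s - (3 / d / sqrt (2 ^ j))\<^sup>2 / 2 * real N)"
        by (simp add: t_def r_def)
    qed
  qed
qed

context honest_play
begin

text \<open>The exponentials form a nonnegative supermartingale: averaging over a fair sign multiplies them by
  \<open>cosh l\<close>, and the correction \<open>exp (- l\<^sup>2 / 2)\<close> makes up for it.\<close>

lemma exponential_tail:
  assumes "0 < c"
  shows "prob {w. \<exists>n. c \<le> exp (\<Sum>k<n. if moves p k then l * real_of_int (w k) - l\<^sup>2 / 2 else 0)} \<le> 1 / c"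
    and "{w. \<exists>n. c \<le> exp (\<Sum>k<n. if moves p k then l * real_of_int (w k) - l\<^sup>2 / 2 else 0)} \<in> events"
proof -
  define g where "g k w = (if moves p k then l * real_of_int (w k) - l\<^sup>2 / 2 else 0)"
    for k and w :: "nat \<Rightarrow> int"
  define Z where "Z n w = exp (\<Sum>k<n. g k w)" for n w
  have upd: "Z (Suc n) (w(n := x)) =
      Z n w * (if moves p n then exp (l * real_of_int x - l\<^sup>2 / 2) else 1)" for n w x
  proof -
    have "(\<Sum>k<n. g k (w(n := x))) = (\<Sum>k<n. g k w)"
      by (intro sum.cong refl) (simp add: g_def)
    then show ?thesis by (simp add: Z_def exp_add g_def)
  qed
  have Z: "honest_supermartingale p Z"
    unfolding honest_supermartingale_def
  proof (intro conjI allI impI)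
    fix n w
    show "0 \<le> Z n w" by (simp add: Z_def)
    have "prefix_determined n (\<lambda>w. \<Sum>k<n. g k w)"
      by (rule prefix_determined_sum) (simp add: prefix_determined_def g_def)
    then show "prefix_determined n (Z n)"
      unfolding prefix_determined_def Z_def by metis
    show "Z (Suc n) (w(n := x)) \<le> Z n w" if "\<not> moves p n" for x
      using that by (simp add: upd)
    have exp_split: "exp (l * real_of_int x - l\<^sup>2 / 2) = exp (l * real_of_int x) * exp (- (l\<^sup>2 / 2))" for x
      by (simp flip: exp_add)
    assume "moves p n"
    then have "Z (Suc n) (w(n := 1)) + Z (Suc n) (w(n := -1)) = 2 * Z n w * (cosh l * exp (- (l\<^sup>2 / 2)))"
      using exp_split[of 1] exp_split[of "-1"] by (simp add: upd cosh_def algebra_simps)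
    also have "\<dots> \<le> 2 * Z n w * (exp (l\<^sup>2 / 2) * exp (- (l\<^sup>2 / 2)))"
      by (intro mult_left_mono mult_right_mono cosh_le_exp_half_square) (auto simp: Z_def)
    also have "\<dots> = 2 * Z n w"
      by (simp flip: exp_add)
    finally show "Z (Suc n) (w(n := 1)) + Z (Suc n) (w(n := -1)) \<le> 2 * Z n w" .
  qed
  show "prob {w. \<exists>n. c \<le> exp (\<Sum>k<n. if moves p k then l * real_of_int (w k) - l\<^sup>2 / 2 else 0)} \<le> 1 / c"
    using ville_inequality[OF Z assms] by (simp add: Z_def g_def)
  show "{w. \<exists>n. c \<le> exp (\<Sum>k<n. if moves p k then l * real_of_int (w k) - l\<^sup>2 / 2 else 0)} \<in> events"
    using sets_reach[OF Z, of UNIV c] by (simp add: Z_def g_def)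
qed

text \<open>By \<open>exponential_tail\<close> the exponential supermartingale of the \<open>j\<close>-th dyadic block reaches the level
  \<open>j\<^sup>2\<close> with probability at most \<open>1 / j\<^sup>2\<close>, which is summable.\<close>

lemma AE_own_sum_le:
  assumes d: "0 < d"
  shows "AE w in play_law S. eventually (\<lambda>N. real_of_int (own_sum p w N)
    \<le> d * (sqrt (real N) * ln (ln (real N)))) sequentially"
proof -
  define l where "l j = 3 / d / sqrt (2 ^ j)" for j :: nat
  \<comment> \<open>The block \<open>j = 0\<close> is skipped since the level \<open>0\<^sup>2\<close> is always reached.\<close>
  define A where "A j = {w. \<exists>n. (real (Suc j))\<^sup>2 \<le>
    exp (\<Sum>k<n. if moves p k then l (Suc j) * real_of_int (w k) - (l (Suc j))\<^sup>2 / 2 else 0)}" for j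
  have "prob (A j) \<le> inverse ((real (Suc j))\<^sup>2)" for j
    using exponential_tail(1)[of "(real (Suc j))\<^sup>2" "l (Suc j)"] by (simp add: A_def inverse_eq_divide)
  moreover have "summable (\<lambda>j. inverse ((real (Suc j))\<^sup>2))"
    using inverse_power_summable[of 2, where 'a = real] by (subst summable_Suc_iff) simp
  ultimately have "summable (\<lambda>j. prob (A j))"
    by (intro summable_comparison_test'[of _ 0 "\<lambda>j. prob (A j)"]) auto
  moreover have "A j \<in> events" for j
    unfolding A_def by (rule exponential_tail(2)) simp
  ultimately have "AE w in play_law S. eventually (\<lambda>j. w \<in> space (play_law S) - A j) sequentially"
    by (intro borel_cantelli_AE1) (auto simp: less_top[symmetric])
  then show ?thesis
  proof eventually_elim
    case (elim w)
    have dev: "eventually (\<lambda>j. \<forall>N s. 2 ^ Suc j \<le> N \<longrightarrow> N < 2 ^ (Suc j + 1) \<longrightarrow> d * (sqrt (real N) * ln (ln (real N))) < s \<longrightarrow>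
        (real (Suc j))\<^sup>2 \<le> exp (l (Suc j) * s - (l (Suc j))\<^sup>2 / 2 * real N)) sequentially"
      using iterated_log_deviation[OF d, folded l_def] by (subst eventually_sequentially_Suc)
    from eventually_conj[OF elim dev] obtain J where
      out: "\<And>j. J \<le> j \<Longrightarrow> w \<notin> A j" and
      dev: "\<And>j N s. J \<le> j \<Longrightarrow> 2 ^ Suc j \<le> N \<Longrightarrow> N < 2 ^ (Suc j + 1) \<Longrightarrow> d * (sqrt (real N) * ln (ln (real N))) < s \<Longrightarrow>
        (real (Suc j))\<^sup>2 \<le> exp (l (Suc j) * s - (l (Suc j))\<^sup>2 / 2 * real N)"
      unfolding eventually_sequentially by blast
    have "real_of_int (own_sum p w N) \<le> d * (sqrt (real N) * ln (ln (real N)))" if N: "2 ^ Suc J \<le> N" for N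
    proof (rule ccontr)
      assume large: "\<not> real_of_int (own_sum p w N) \<le> d * (sqrt (real N) * ln (ln (real N)))"
      have "1 \<le> N" using N by (metis one_le_numeral one_le_power order.trans)
      then obtain i where i: "2 ^ i \<le> N" "N < 2 ^ (i + 1)"
        using ex_power_ivl1[of 2 N] by auto
      have "(2::nat) ^ Suc J < 2 ^ (i + 1)" using N i(2) by (rule le_less_trans)
      then have "Suc J < i + 1" by (rule power_less_imp_less_exp[rotated]) simp
      then obtain j where j: "i = Suc j" "J \<le> j" by (cases i) auto
      have "(\<Sum>k<2*N. if moves p k then l (Suc j) * real_of_int (w k) - (l (Suc j))\<^sup>2 / 2 else 0)
          = (\<Sum>n=1..N. l (Suc j) * real_of_int (own_move p w n) - (l (Suc j))\<^sup>2 / 2)"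
        by (subst sum_own_turns) (simp add: own_move_eq)
      also have "\<dots> = l (Suc j) * real_of_int (own_sum p w N) - (l (Suc j))\<^sup>2 / 2 * real N"
        by (simp add: own_sum_def sum_subtractf sum_distrib_left)
      finally have "w \<in> A j"
        using dev[OF j(2), of N "real_of_int (own_sum p w N)"] large i
        unfolding A_def j(1) by (auto intro!: exI[of _ "2*N"])
      with out[OF j(2)] show False by simp
    qed
    then show ?case unfolding eventually_sequentially by blast
  qed
qed

lemma AE_limsup_own_sum:
  "AE w in play_law S. \<not> 0 < limsup (\<lambda>n. ereal (real_of_int (own_sum p w n) / (sqrt (real n) * ln (ln (real n)))))"
proof -
  have "AE w in play_law S. \<forall>j. eventually (\<lambda>N. real_of_int (own_sum p w N)
    \<le> inverse (real (Suc j)) * (sqrt (real N) * ln (ln (real N)))) sequentially"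
    unfolding AE_all_countable by (intro allI AE_own_sum_le) simp
  then show ?thesis
  proof eventually_elim
    case (elim w)
    let ?q = "\<lambda>n. ereal (real_of_int (own_sum p w n) / (sqrt (real n) * ln (ln (real n))))"
    have pos: "eventually (\<lambda>n::nat. 0 < sqrt (real n) * ln (ln (real n))) sequentially"
      by real_asymp
    have le: "limsup ?q \<le> ereal (inverse (real (Suc j)))" for j
    proof (rule Limsup_bounded)
      show "eventually (\<lambda>n. ?q n \<le> ereal (inverse (real (Suc j)))) sequentially"
        using spec[OF elim, of j] pos by eventually_elim (simp only: ereal_less_eq pos_divide_le_eq)
    qed
    have lim: "(\<lambda>j. ereal (inverse (real (Suc j)))) \<longlonglongrightarrow> ereal 0"
      using LIMSEQ_inverse_real_of_nat by (simp only: tendsto_ereal)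
    have "limsup ?q \<le> ereal 0"
      by (rule LIMSEQ_le_const[OF lim]) (use le in blast)
    then show ?case by (simp add: not_less zero_ereal_def)
  qed
qed

section \<open>The series of the honest player\<close>

text \<open>The squared weights are summable because \<open>2 \<cdot> 3/4 > 1\<close>.\<close>

lemma AE_weighted_own_series:
  "AE w in play_law S. convergent (\<lambda>N. \<Sum>n=2..N. own_move p w n / (sqrt n * ln n powr (3/4)))"
proof -
  define F where "F k w = (if moves p k \<and> 2 \<le> k then weight (real (k div 2 + 1)) else 0)"
    for k and w :: "nat \<Rightarrow> int"
  have weight_nonneg: "0 \<le> weight (real n)" for n
    unfolding weight_def by simp
  have "AE w in play_law S. convergent (\<lambda>n. \<Sum>k<n. F k w * real_of_int (w k))"
  proof (rule AE_convergent_transform)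
    show "summable (\<lambda>k. (weight (real (k div 2 + 1)))\<^sup>2)" by (rule summable_weight_round)
    show "\<bar>F k w\<bar> \<le> weight (real (k div 2 + 1))" for k w
      using weight_nonneg[of "k div 2 + 1"] by (simp add: F_def)
  qed (auto simp: F_def prefix_determined_def)
  then show ?thesis
  proof eventually_elim
    case (elim w)
    have "convergent ((\<lambda>n. \<Sum>k<n. F k w * real_of_int (w k)) \<circ> (\<lambda>N. 2 * N))"
      by (rule convergent_subseq_convergent[OF elim]) (simp add: strict_mono_def)
    also have "(\<lambda>n. \<Sum>k<n. F k w * real_of_int (w k)) \<circ> (\<lambda>N. 2 * N)
        = (\<lambda>N. \<Sum>n=2..N. own_move p w n / (sqrt n * ln n powr (3/4)))"
    proof
      fix N
      let ?g = "\<lambda>k. if 2 \<le> k then weight (real (k div 2 + 1)) * real_of_int (w k) else 0"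
      have "((\<lambda>n. \<Sum>k<n. F k w * real_of_int (w k)) \<circ> (\<lambda>N. 2 * N)) N
          = (\<Sum>k<2*N. if moves p k then ?g k else 0)"
        unfolding comp_def by (intro sum.cong refl) (simp add: F_def)
      also have "\<dots> = (\<Sum>n=1..N. ?g (own_index p n))" by (rule sum_own_turns)
      also have "\<dots> = (\<Sum>n=2..N. ?g (own_index p n))"
        by (rule sum.mono_neutral_right) (auto simp: own_index_def split: player.splits)
      also have "\<dots> = (\<Sum>n=2..N. own_move p w n / (sqrt n * ln n powr (3/4)))"
      proof (intro sum.cong refl)
        fix n assume n: "n \<in> {2..N}"
        then have "own_index p n div 2 + 1 = n" "2 \<le> own_index p n"
          by (auto simp: own_index_def split: player.splits)
        then show "?g (own_index p n) = own_move p w n / (sqrt n * ln n powr (3/4))"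
          using n by (simp add: own_move_eq weight_def)
      qed
      finally show "((\<lambda>n. \<Sum>k<n. F k w * real_of_int (w k)) \<circ> (\<lambda>N. 2 * N)) N
          = (\<Sum>n=2..N. own_move p w n / (sqrt n * ln n powr (3/4)))" .
    qed
    finally show ?case .
  qed
qed

end

text \<open>The third-step series sum these quantities over the even and over the odd \<open>k\<close>; the step from time
  \<open>k\<close> to time \<open>k + 1\<close> is the term of index \<open>k\<close>.\<close>

definition log_increment :: "(nat \<Rightarrow> int) \<Rightarrow> nat \<Rightarrow> real" where
  "log_increment w k = real_of_int ((walk w (Suc k))\<^sup>2 - (walk w k)\<^sup>2) / (real k * ln (real k))"

lemma filterlim_partial_sums_at_top:
  fixes f :: "nat \<Rightarrow> real"
  assumes nonneg: "\<And>n. 0 \<le> f n" and "\<not> summable f"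
  shows "filterlim (\<lambda>n. \<Sum>k<n. f k) at_top sequentially"
  unfolding filterlim_at_top
proof
  fix Z
  have "\<exists>n. Z < (\<Sum>k<n. f k)"
    using assms summableI_nonneg_bounded[of f Z] by (meson not_le)
  then obtain n where n: "Z < (\<Sum>k<n. f k)" by blast
  have "(\<Sum>k<n. f k) \<le> (\<Sum>k<m. f k)" if "n \<le> m" for m
    using that nonneg by (intro sum_mono2) auto
  with n show "eventually (\<lambda>n. Z \<le> (\<Sum>k<n. f k)) sequentially"
    unfolding eventually_sequentially by (meson less_le_trans less_imp_le)
qed

lemma honest_drift_at_top:
  "filterlim (\<lambda>K. \<Sum>k<K. if moves p k \<and> 2 \<le> k then 1 / (real k * ln (real k)) else 0) at_top sequentially"
proof (rule filterlim_partial_sums_at_top)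
  let ?f = "\<lambda>k. if moves p k \<and> 2 \<le> k then 1 / (real k * ln (real k)) else 0"
  show nonneg: "0 \<le> ?f k" for k by (auto intro: ln_ge_zero)
  show "\<not> summable ?f"
  proof
    assume "summable ?f"
    let ?r = "(case p of PlayerA \<Rightarrow> 0 | PlayerB \<Rightarrow> 1) :: nat"
    have "summable (?f \<circ> (\<lambda>j. 2 * j + ?r))"
      by (rule summable_reindex[OF \<open>summable ?f\<close>]) (auto simp: inj_def nonneg)
    moreover have "eventually (\<lambda>j. (?f \<circ> (\<lambda>j. 2 * j + ?r)) j =
        1 / (real (2*j+?r) * ln (real (2*j+?r)))) sequentially"
      using eventually_ge_at_top[of 1]
      by eventually_elim (auto simp: moves_def split: player.splits)
    ultimately have "summable (\<lambda>j. 1 / (real (2*j+?r) * ln (real (2*j+?r))))"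
      by (rule summable_cong[THEN iffD1, rotated])
    then show False
      using not_summable_recip_log[of ?r] by (simp split: player.splits)
  qed
qed

context honest_play
begin

text \<open>The growth of the squared walk at a turn of the honest player is \<open>1\<close> plus twice a martingale
  increment. The constant part diverges by \<open>honest_drift_at_top\<close>. In the martingale part the
  coefficients are set to 0 whenever the walk is larger than \<open>\<surd>k (log k)\<^sup>1\<^sup>/\<^sup>4\<close>, which bounds them by
  \<open>weight k\<close> and, under the premise, changes only finitely many terms.\<close>

lemma AE_own_increments_at_top:
  "AE w in play_law S.
     eventually (\<lambda>k. \<bar>real_of_int (walk w k)\<bar> \<le> sqrt (real k) * ln (real k) powr (1/4)) sequentially \<longrightarrow>
     filterlim (\<lambda>K. \<Sum>k<K. if moves p k \<and> 2 \<le> k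
       then log_increment w k else 0) at_top sequentially"
proof -
  let ?small = "\<lambda>w k. \<bar>real_of_int (walk w k)\<bar> \<le> sqrt (real k) * ln (real k) powr (1/4)"
  define F where "F k w = (if moves p k \<and> 2 \<le> k \<and> ?small w k
    then real_of_int (walk w k) / (real k * ln (real k)) else 0)" for k w
  have "AE w in play_law S. convergent (\<lambda>n. \<Sum>k<n. F k w * real_of_int (w k))"
  proof (rule AE_convergent_transform)
    show "summable (\<lambda>k. (weight (real k))\<^sup>2)" by (rule summable_weight)
    show "prefix_determined k (F k)" for k
    proof -
      have "prefix_determined k (\<lambda>w. walk w k)"
        unfolding prefix_determined_def walk_eq by (intro allI impI arg_cong2[of _ _ _ _ "(+)"] sum.cong refl) auto
      then have eq: "\<forall>i<k. w i = w' i \<Longrightarrow> walk w k = walk w' k" for w w'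
        by (simp add: prefix_determined_def)
      show ?thesis
        unfolding prefix_determined_def F_def by (intro allI impI) (simp only: eq)
    qed
    show "\<bar>F k w\<bar> \<le> weight (real k)" for k w
    proof (cases "2 \<le> k \<and> ?small w k")
      case True
      then have pos: "0 < real k" "0 < ln (real k)" by auto
      have powr: "ln (real k) powr (1/4) * ln (real k) powr (3/4) = ln (real k)"
        using pos by (simp flip: powr_add)
      have "\<bar>F k w\<bar> \<le> \<bar>real_of_int (walk w k)\<bar> / (real k * ln (real k))"
        using pos by (simp add: F_def abs_divide abs_mult)
      also have "\<dots> \<le> (sqrt (real k) * ln (real k) powr (1/4)) / (real k * ln (real k))"
        using True pos by (intro divide_right_mono) auto
      also have "\<dots> = weight (real k)"
      proof -
        have "real k * ln (real k) = (sqrt (real k) * ln (real k) powr (1/4)) * (sqrt (real k) * ln (real k) powr (3/4))"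
          using powr pos by (simp add: algebra_simps)
        then show ?thesis using pos by (simp add: weight_def)
      qed
      finally show ?thesis .
    qed (auto simp: F_def weight_def)
  qed (auto simp: F_def)
  then show ?thesis
    using AE_sign_seqs
  proof eventually_elim
    case (elim w)
    show ?case
    proof
      assume small: "eventually (?small w) sequentially"
      \<comment> \<open>The truncation error \<open>R\<close> vanishes eventually.\<close>
      define h where "h k = (if moves p k \<and> 2 \<le> k then 1 / (real k * ln (real k)) else 0)" for k
      define R where "R k = (if moves p k \<and> 2 \<le> k \<and> \<not> ?small w k
        then 2 * real_of_int (walk w k) / (real k * ln (real k)) * real_of_int (w k) else 0)" for k
      have "summable R"
        by (subst summable_cong[of _ "\<lambda>_. 0"]) (use small in \<open>auto simp: R_def elim!: eventually_mono\<close>)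
      then obtain r where r: "(\<lambda>K. \<Sum>k<K. R k) \<longlonglongrightarrow> r"
        by (auto simp: summable_def sums_def)
      from elim(1) obtain m where m: "(\<lambda>n. \<Sum>k<n. F k w * real_of_int (w k)) \<longlonglongrightarrow> m"
        by (auto simp: convergent_def)
      have "(\<lambda>K. 2 * (\<Sum>k<K. F k w * real_of_int (w k)) + (\<Sum>k<K. R k)) \<longlonglongrightarrow> 2 * m + r"
        by (intro tendsto_intros m r)
      then have "filterlim (\<lambda>K. (2 * (\<Sum>k<K. F k w * real_of_int (w k)) + (\<Sum>k<K. R k)) + (\<Sum>k<K. h k)) at_top sequentially"
        unfolding h_def by (rule filterlim_tendsto_add_at_top[OF _ honest_drift_at_top])
      moreover have "(2 * (\<Sum>k<K. F k w * real_of_int (w k)) + (\<Sum>k<K. R k)) + (\<Sum>k<K. h k) =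
          (\<Sum>k<K. if moves p k \<and> 2 \<le> k
            then log_increment w k else 0)" for K
      proof -
        have sq: "(walk w (Suc k))\<^sup>2 - (walk w k)\<^sup>2 = 1 + 2 * walk w k * w k" for k
        proof -
          have "w k = 1 \<or> w k = -1" using elim(2) by (auto simp: sign_seqs_def)
          then show ?thesis by (auto simp: walk_Suc power2_eq_square algebra_simps)
        qed
        show ?thesis
          unfolding sum_distrib_left sum.distrib[symmetric]
          by (intro sum.cong refl) (simp add: log_increment_def sq F_def R_def h_def add_divide_distrib)
      qed
      ultimately show "filterlim (\<lambda>K. \<Sum>k<K. if moves p k \<and> 2 \<le> k
            then log_increment w k else 0) at_top sequentially"
        by simp
    qed
  qed
qed

end

section \<open>The total growth of the squared walk\<close>

lemma sum_by_parts:
  fixes g v :: "nat \<Rightarrow> real"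
  assumes "m \<le> M"
  shows "(\<Sum>k=m..M. g k * (v (Suc k) - v k)) =
    g M * v (Suc M) - g m * v m + (\<Sum>k=Suc m..M. v k * (g (k - 1) - g k))"
  using assms
proof (induction M rule: dec_induct)
  case (step M)
  then show ?case by (simp add: algebra_simps)
qed (simp add: algebra_simps)

text \<open>The weighted sum of the increments of the walk over the rounds converges. Summation by parts turns
  it into a nonnegative boundary term, a constant, and the partial sums of the series in question,
  whose terms are nonnegative from \<open>n = 2\<close> on because the walk is positive and \<open>weight\<close> decreases.\<close>

lemma summable_walk_weight_differences:
  assumes w: "w \<in> sign_seqs - D_set"
    and A: "convergent (\<lambda>N. \<Sum>n=2..N. move_A w n / (sqrt n * ln n powr (3/4)))"
    and B: "convergent (\<lambda>N. \<Sum>n=2..N. move_B w n / (sqrt n * ln n powr (3/4)))"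
  shows "summable (\<lambda>n. walk w (2 * n) * (weight (real n) - weight (real (Suc n))))"
proof -
  let ?u = "\<lambda>n. real_of_int (walk w (2 * n))"
  define h where "h n = ?u n * (weight (real n) - weight (real (Suc n)))" for n
  have u: "1 \<le> ?u n" for n using walk_ge_1[OF w, of "2 * n"] by simp
  have h_nonneg: "0 \<le> h n" if "2 \<le> n" for n
    using weight_antimono[of "real n" "real (Suc n)"] that u[of n] by (simp add: h_def)
  have incr: "?u (Suc k) - ?u k = real_of_int (move_A w (Suc k)) + real_of_int (move_B w (Suc k))" for k
    unfolding walk_even_eq own_sum_simps sum_A_def sum_B_def by simp
  have "convergent (\<lambda>N. (\<Sum>n=2..N. move_A w n / (sqrt n * ln n powr (3/4))) +
      (\<Sum>n=2..N. move_B w n / (sqrt n * ln n powr (3/4))))"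
    by (rule convergent_add[OF A B])
  from convergent_imp_Bseq[OF this] obtain C where "\<And>N. norm ((\<Sum>n=2..N. move_A w n / (sqrt n * ln n powr (3/4))) +
      (\<Sum>n=2..N. move_B w n / (sqrt n * ln n powr (3/4)))) \<le> C"
    by (elim BseqE) blast
  then have C: "(\<Sum>n=2..N. move_A w n / (sqrt n * ln n powr (3/4))) +
      (\<Sum>n=2..N. move_B w n / (sqrt n * ln n powr (3/4))) \<le> C" for N
    unfolding real_norm_def by (rule abs_le_D1)
  have bound: "(\<Sum>k=2..M. h k) \<le> C + weight 2 * ?u 1" if "1 \<le> M" for M
  proof -
    have "(\<Sum>n=2..Suc M. move_A w n / (sqrt n * ln n powr (3/4))) +
        (\<Sum>n=2..Suc M. move_B w n / (sqrt n * ln n powr (3/4)))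
      = (\<Sum>n=Suc 1..Suc M. weight (real n) * (?u n - ?u (n - 1)))"
      unfolding sum.distrib[symmetric]
    proof (intro sum.cong)
      fix n assume "n \<in> {Suc 1..Suc M}"
      then obtain k where "n = Suc k" by (cases n) auto
      then show "move_A w n / (sqrt n * ln n powr (3/4)) + move_B w n / (sqrt n * ln n powr (3/4))
          = weight (real n) * (?u n - ?u (n - 1))"
        using incr[of k] by (simp add: weight_def add_divide_distrib)
    qed simp
    also have "\<dots> = (\<Sum>k=1..M. weight (real (Suc k)) * (?u (Suc k) - ?u k))"
      by (subst sum.shift_bounds_cl_Suc_ivl) simp
    also have "\<dots> = weight (real (Suc M)) * ?u (Suc M) - weight (real (Suc 1)) * ?u 1
        + (\<Sum>k=Suc 1..M. ?u k * (weight (real (Suc (k - 1))) - weight (real (Suc k))))"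
      by (rule sum_by_parts[OF that])
    also have "(\<Sum>k=Suc 1..M. ?u k * (weight (real (Suc (k - 1))) - weight (real (Suc k)))) = (\<Sum>k=2..M. h k)"
      by (intro sum.cong) (auto simp: h_def)
    finally have "weight (real (Suc M)) * ?u (Suc M) - weight (real (Suc 1)) * ?u 1 + (\<Sum>k=2..M. h k) \<le> C"
      using C[of "Suc M"] by simp
    moreover have "0 \<le> weight (real (Suc M)) * ?u (Suc M)"
      using u[of "Suc M"] by (simp add: weight_def)
    ultimately show ?thesis by (simp add: numeral_2_eq_2)
  qed
  define h' where "h' n = (if 2 \<le> n then h n else 0)" for n
  have "summable h'"
  proof (rule summableI_nonneg_bounded)
    show "0 \<le> h' n" for n using h_nonneg by (simp add: h'_def)
    show "(\<Sum>n<N. h' n) \<le> C + weight 2 * ?u 1" for N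
    proof -
      have "(\<Sum>n<N. h' n) \<le> (\<Sum>n\<le>Suc N. h' n)"
        using h_nonneg by (intro sum_mono2) (auto simp: h'_def)
      also have "\<dots> = (\<Sum>k=2..Suc N. h k)"
        by (rule sum.mono_neutral_cong_right) (auto simp: h'_def)
      also have "\<dots> \<le> C + weight 2 * ?u 1" by (rule bound) simp
      finally show ?thesis .
    qed
  qed
  moreover have "eventually (\<lambda>n. h' n = h n) sequentially"
    using eventually_ge_at_top[of 2] by eventually_elim (simp add: h'_def)
  ultimately show ?thesis
    unfolding h_def[symmetric] by (rule summable_cong[THEN iffD1, rotated])
qed

text \<open>Summation by parts leaves a boundary term, at most 1 in the end because the walk is below
  \<open>\<surd>k (log k)\<^sup>1\<^sup>/\<^sup>4\<close>, and the sum of \<open>s\<^sub>k\<^sup>2\<close> times the differences of \<open>1 / (k log k)\<close>. One factor \<open>s\<^sub>k\<close> is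
  absorbed by \<open>drift_weight_comparison\<close>, the other is at most twice the position after the last
  completed round, so that \<open>summable_walk_weight_differences\<close> applies.\<close>

lemma total_increments_bounded:
  assumes w: "w \<in> sign_seqs - D_set"
    and small: "eventually (\<lambda>k. \<bar>real_of_int (walk w k)\<bar> \<le> sqrt (real k) * ln (real k) powr (1/4)) sequentially"
    and A: "convergent (\<lambda>N. \<Sum>n=2..N. move_A w n / (sqrt n * ln n powr (3/4)))"
    and B: "convergent (\<lambda>N. \<Sum>n=2..N. move_B w n / (sqrt n * ln n powr (3/4)))"
  shows "\<exists>C. eventually (\<lambda>M. (\<Sum>k=2..M. log_increment w k) \<le> C) sequentially"
proof -
  let ?s = "\<lambda>k. real_of_int (walk w k)"
  let ?g = "\<lambda>k::nat. 1 / (real k * ln (real k))"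
  let ?b = "\<lambda>k::nat. sqrt (real k) * ln (real k) powr (1/4)"
  define h where "h n = ?s (2 * n) * (weight (real n) - weight (real (Suc n)))" for n
  define e where "e k = (if 3 \<le> k then (?s k)\<^sup>2 * (?g (k - 1) - ?g k) else 0)" for k
  have s: "1 \<le> ?s k" for k using walk_ge_1[OF w, of k] by simp
  have g_mono: "0 \<le> ?g (k - 1) - ?g k" if "3 \<le> k" for k
  proof -
    have le: "real (k - 1) * ln (real (k - 1)) \<le> real k * ln (real k)"
      using that by (intro mult_mono ln_mono) auto
    have pos: "0 < real (k - 1) * ln (real (k - 1))" using that by auto
    have "?g k \<le> ?g (k - 1)" by (rule frac_le[OF _ _ pos le]) simp_all
    then show ?thesis by simp
  qed
  have e_nonneg: "0 \<le> e k" for k using g_mono by (simp add: e_def)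
  obtain C where C: "0 \<le> C" "eventually (\<lambda>k. ?b k * (?g (k - 1) - ?g k)
      \<le> C * (weight (real (k div 2)) - weight (real (Suc (k div 2))))) sequentially"
    using drift_weight_comparison by blast
  have "summable h"
    unfolding h_def using summable_walk_weight_differences[OF w A B] by simp
  have "summable (\<lambda>k. h (k div 2))"
  proof -
    have "(\<lambda>k. if even k then h (k div 2) else h ((k - 1) div 2)) sums (suminf h + suminf h)"
      by (rule sums_if) (rule summable_sums[OF \<open>summable h\<close>])+
    moreover have "(if even k then h (k div 2) else h ((k - 1) div 2)) = h (k div 2)" for k
      by (auto elim!: oddE)
    ultimately show ?thesis by (simp add: sums_iff)
  qed
  have "summable e"
  proof (rule summable_comparison_test_ev)
    show "summable (\<lambda>k. 2 * C * h (k div 2))"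
      by (intro summable_mult \<open>summable (\<lambda>k. h (k div 2))\<close>)
    show "eventually (\<lambda>k. norm (e k) \<le> 2 * C * h (k div 2)) sequentially"
      using small C(2) eventually_ge_at_top[of 3]
    proof eventually_elim
      case (elim k)
      have "walk w k \<le> walk w (2 * (k div 2)) + 1"
        using walk_le_walk_even w by blast
      then have two: "?s k \<le> 2 * ?s (2 * (k div 2))"
        using s[of "2 * (k div 2)"] by linarith
      have "norm (e k) = ?s k * (?s k * (?g (k - 1) - ?g k))"
        using e_nonneg[of k] elim by (simp add: e_def power2_eq_square)
      also have "\<dots> \<le> ?s k * (?b k * (?g (k - 1) - ?g k))"
        using elim s[of k] g_mono[of k] by (intro mult_left_mono mult_right_mono) auto
      also have "\<dots> \<le> ?s k * (C * (weight (real (k div 2)) - weight (real (Suc (k div 2)))))"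
        using elim s[of k] by (intro mult_left_mono) auto
      also have "\<dots> \<le> 2 * ?s (2 * (k div 2)) * (C * (weight (real (k div 2)) - weight (real (Suc (k div 2)))))"
      proof (intro mult_right_mono two)
        have "0 \<le> ?b k * (?g (k - 1) - ?g k)"
          using g_mono[of k] elim by (intro mult_nonneg_nonneg) auto
        then show "0 \<le> C * (weight (real (k div 2)) - weight (real (Suc (k div 2))))"
          using elim by linarith
      qed
      finally show ?case by (simp add: h_def algebra_simps)
    qed
  qed
  have shift: "eventually (\<lambda>M. \<bar>?s (Suc M)\<bar> \<le> ?b (Suc M)) sequentially"
    using small by (subst eventually_sequentially_Suc)
  have vanish: "eventually (\<lambda>M. ?g M * (?b (Suc M))\<^sup>2 \<le> 1) sequentially"
    by real_asymp
  have "eventually (\<lambda>M. (\<Sum>k=2..M. log_increment w k) \<le> 1 + suminf e) sequentially"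
    using shift vanish eventually_ge_at_top[of 2]
  proof eventually_elim
    case (elim M)
    have "(\<Sum>k=2..M. log_increment w k)
        = (\<Sum>k=2..M. ?g k * ((?s (Suc k))\<^sup>2 - (?s k)\<^sup>2))"
      by (simp add: log_increment_def)
    also have "\<dots> = ?g M * (?s (Suc M))\<^sup>2 - ?g 2 * (?s 2)\<^sup>2 + (\<Sum>k=Suc 2..M. (?s k)\<^sup>2 * (?g (k - 1) - ?g k))"
      by (rule sum_by_parts[of 2 M ?g "\<lambda>k. (?s k)\<^sup>2"]) (use elim in simp)
    also have "(\<Sum>k=Suc 2..M. (?s k)\<^sup>2 * (?g (k - 1) - ?g k)) = (\<Sum>k=Suc 2..M. e k)"
      by (intro sum.cong) (auto simp: e_def)
    also have "\<dots> \<le> suminf e"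
      by (rule sum_le_suminf[OF \<open>summable e\<close>]) (auto simp: e_nonneg)
    finally have "(\<Sum>k=2..M. log_increment w k)
        \<le> ?g M * (?s (Suc M))\<^sup>2 - ?g 2 * (?s 2)\<^sup>2 + suminf e" by simp
    moreover have "?g M * (?s (Suc M))\<^sup>2 \<le> ?g M * (?b (Suc M))\<^sup>2"
      using elim s[of "Suc M"] by (intro mult_left_mono power_mono) auto
    moreover have "0 \<le> ?g 2 * (?s 2)\<^sup>2" by simp
    ultimately show ?case using elim(2) by linarith
  qed
  then show ?thesis by blast
qed

lemma sum_even_odd:
  fixes G :: "nat \<Rightarrow> 'a :: comm_monoid_add"
  shows "(\<Sum>n=1..N. G (2 * n)) + (\<Sum>n=2..N. G (2 * n - 1)) = (\<Sum>k=2..2*N. G k)"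
proof (induction N)
  case (Suc N)
  show ?case
  proof (cases "N = 0")
    case False
    then have "(\<Sum>k=2..2*Suc N. G k) = (\<Sum>k=2..2*N. G k) + G (Suc (2*N)) + G (2 * Suc N)"
      by simp
    also have "\<dots> = (\<Sum>n=1..Suc N. G (2 * n)) + (\<Sum>n=2..Suc N. G (2 * n - 1))"
      using False unfolding Suc[symmetric] by (simp add: algebra_simps)
    finally show ?thesis by simp
  qed (simp add: numeral_2_eq_2)
qed simp

text \<open>The term \<open>k = 0\<close> is the only turn of A that is left out, so \<open>N\<close> summands correspond to \<open>N + 1\<close>
  rounds.\<close>

lemma series_A_increments:
  fixes G :: "nat \<Rightarrow> 'a :: comm_monoid_add"
  shows "(\<Sum>k<2 * Suc N. if moves PlayerA k \<and> 2 \<le> k then G k else 0) = (\<Sum>n=1..N. G (2 * n))"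
proof (induction N)
  case (Suc N)
  let ?f = "\<lambda>k. if moves PlayerA k \<and> 2 \<le> k then G k else 0"
  have "(\<Sum>k<2 * Suc (Suc N). ?f k) = (\<Sum>k<2 * Suc N. ?f k) + ?f (2 * Suc N) + ?f (Suc (2 * Suc N))"
    by simp
  then show ?case by (simp only: Suc) (simp add: moves_def)
qed (simp add: moves_def numeral_2_eq_2)

lemma series_B_increments:
  fixes G :: "nat \<Rightarrow> 'a :: comm_monoid_add"
  shows "(\<Sum>k<2 * N. if moves PlayerB k \<and> 2 \<le> k then G k else 0) = (\<Sum>n=2..N. G (2 * n - 1))"
proof (induction N)
  case (Suc N)
  then show ?case by (cases N) (auto simp: moves_def)
qed simp

lemma series_infinite_A:
  assumes "filterlim (\<lambda>K. \<Sum>k<K. if moves PlayerA k \<and> 2 \<le> k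
       then log_increment w k else 0) at_top sequentially"
  shows "series_infinite 1 (\<lambda>n. ((walk w (2*n+1))\<^sup>2 - (walk w (2*n))\<^sup>2) / (2*n * ln (2*n)))"
proof -
  have "filterlim (\<lambda>N::nat. 2 * Suc N) sequentially sequentially"
    by (rule filterlim_subseq) (simp add: strict_mono_def)
  from filterlim_compose[OF assms this] show ?thesis
    unfolding series_infinite_def series_A_increments log_increment_def by simp
qed

lemma series_infinite_B:
  assumes "filterlim (\<lambda>K. \<Sum>k<K. if moves PlayerB k \<and> 2 \<le> k
       then log_increment w k else 0) at_top sequentially"
  shows "series_infinite 2 (\<lambda>n. ((walk w (2*n))\<^sup>2 - (walk w (2*n-1))\<^sup>2) / ((2*n-1) * ln (2*n-1)))"
proof -
  have "filterlim (\<lambda>N::nat. 2 * N) sequentially sequentially"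
    by (rule filterlim_subseq) (simp add: strict_mono_def)
  from filterlim_compose[OF assms this]
  have "filterlim (\<lambda>N. \<Sum>n=2..N. real_of_int ((walk w (Suc (2*n-1)))\<^sup>2 - (walk w (2*n-1))\<^sup>2) /
      (real (2*n-1) * ln (real (2*n-1)))) at_top sequentially"
    unfolding series_B_increments log_increment_def .
  also have "(\<lambda>N. \<Sum>n=2..N. real_of_int ((walk w (Suc (2*n-1)))\<^sup>2 - (walk w (2*n-1))\<^sup>2) /
      (real (2*n-1) * ln (real (2*n-1)))) =
     (\<lambda>N. \<Sum>n=2..N. real_of_int ((walk w (2*n))\<^sup>2 - (walk w (2*n-1))\<^sup>2) /
      (real (2*n-1) * ln (real (2*n-1))))"
    by (intro ext sum.cong refl) (simp add: Suc_diff_le[symmetric] del: of_int_diff)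
  finally show ?thesis unfolding series_infinite_def .
qed

text \<open>The two series together make up the bounded total.\<close>

lemma not_both_series_infinite:
  assumes w: "w \<in> sign_seqs - D_set"
    and small: "eventually (\<lambda>k. \<bar>real_of_int (walk w k)\<bar> \<le> sqrt (real k) * ln (real k) powr (1/4)) sequentially"
    and A: "convergent (\<lambda>N. \<Sum>n=2..N. move_A w n / (sqrt n * ln n powr (3/4)))"
    and B: "convergent (\<lambda>N. \<Sum>n=2..N. move_B w n / (sqrt n * ln n powr (3/4)))"
    and inf_A: "series_infinite 1 (\<lambda>n. ((walk w (2*n+1))\<^sup>2 - (walk w (2*n))\<^sup>2) / (2*n * ln (2*n)))"
    and inf_B: "series_infinite 2 (\<lambda>n. ((walk w (2*n))\<^sup>2 - (walk w (2*n-1))\<^sup>2) / ((2*n-1) * ln (2*n-1)))"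
  shows False
proof -
  let ?G = "log_increment w"
  have "filterlim (\<lambda>N. (\<Sum>n=1..N. ?G (2 * n)) + (\<Sum>n=2..N. ?G (2 * n - 1))) at_top sequentially"
  proof (rule filterlim_at_top_add_at_top)
    show "filterlim (\<lambda>N. \<Sum>n=1..N. ?G (2 * n)) at_top sequentially"
      using inf_A unfolding series_infinite_def log_increment_def by simp
    have "(\<Sum>n=2..N. ?G (2 * n - 1)) = (\<Sum>n=2..N. ((walk w (2*n))\<^sup>2 - (walk w (2*n-1))\<^sup>2) / ((2*n-1) * ln (2*n-1)))" for N
      unfolding log_increment_def by (intro sum.cong refl) (simp add: Suc_diff_le[symmetric] del: of_int_diff)
    then show "filterlim (\<lambda>N. \<Sum>n=2..N. ?G (2 * n - 1)) at_top sequentially"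
      using inf_B unfolding series_infinite_def by simp
  qed
  then have inf: "filterlim (\<lambda>N. \<Sum>k=2..2*N. ?G k) at_top sequentially"
    by (simp only: sum_even_odd)
  obtain C where "eventually (\<lambda>M. (\<Sum>k=2..M. ?G k) \<le> C) sequentially"
    using total_increments_bounded[OF w small A B] by blast
  moreover have "filterlim (\<lambda>N::nat. 2 * N) sequentially sequentially"
    by (rule filterlim_subseq) (simp add: strict_mono_def)
  ultimately have "eventually (\<lambda>N. (\<Sum>k=2..2*N. ?G k) \<le> C) sequentially"
    by (rule eventually_compose_filterlim)
  moreover have "eventually (\<lambda>N. C < (\<Sum>k=2..2*N. ?G k)) sequentially"
    using inf by (simp add: filterlim_at_top_dense)
  ultimately have "eventually (\<lambda>N::nat. False) sequentially"
    by eventually_elim simp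
  then show False by simp
qed

section \<open>The blame function\<close>

context honest_play
begin

text \<open>An honest A is absolved by the third step at the latest, which blames B as soon as the series over
  the moves of A is infinite. An honest B could, after the first two steps, only be blamed by an infinite series over the
  moves of A; but the series over the moves of B is infinite, and the two exclude each other.\<close>

lemma AE_blame_not_honest:
  "AE w in play_law S. w \<in> sign_seqs - D_set \<longrightarrow> blame w \<noteq> p"
  using AE_limsup_own_sum AE_weighted_own_series AE_own_increments_at_top
proof eventually_elim
  case (elim w)
  show ?case
  proof (intro impI notI)
    assume w: "w \<in> sign_seqs - D_set" and b: "blame w = p"
    let ?limsup = "\<lambda>s. 0 < limsup (\<lambda>n. ereal (real_of_int (s n) / (sqrt (real n) * ln (ln (real n)))))"
    note small = eventually_walk_le[OF w]
    show False
    proof (cases p)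
      case PlayerA
      have own: "\<not> ?limsup (sum_A w)" "\<not> series_diverges 2 (\<lambda>n. move_A w n / (sqrt n * ln n powr (3/4)))"
        using elim(1,2) unfolding series_diverges_def by (simp_all add: PlayerA own_sum_simps own_move_def)
      have other: "\<not> ?limsup (sum_B w)"
      proof
        assume "?limsup (sum_B w)"
        then have "blame w = PlayerB" unfolding blame_def by (simp only: own(1) if_True if_False)
        then show False using b PlayerA by simp
      qed
      from small[OF own(1) other] elim(3)
      have "series_infinite 1 (\<lambda>n. ((walk w (2*n+1))\<^sup>2 - (walk w (2*n))\<^sup>2) / (2*n * ln (2*n)))"
        unfolding PlayerA by (intro series_infinite_A) blast
      then have "blame w = PlayerB"
        unfolding blame_def by (simp only: own other if_True if_False if_cancel)
      then show False using b PlayerA by simp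
    next
      case PlayerB
      have own: "\<not> ?limsup (sum_B w)" "\<not> series_diverges 2 (\<lambda>n. move_B w n / (sqrt n * ln n powr (3/4)))"
        using elim(1,2) unfolding series_diverges_def by (simp_all add: PlayerB own_sum_simps own_move_def)
      have not_A: "blame w \<noteq> PlayerA" using b PlayerB by simp
      have other1: "\<not> ?limsup (sum_A w)"
      proof
        assume "?limsup (sum_A w)"
        then have "blame w = PlayerA" unfolding blame_def by (simp only: if_True if_False)
        then show False using not_A by simp
      qed
      have other2: "\<not> series_diverges 2 (\<lambda>n. move_A w n / (sqrt n * ln n powr (3/4)))"
      proof
        assume "series_diverges 2 (\<lambda>n. move_A w n / (sqrt n * ln n powr (3/4)))"
        then have "blame w = PlayerA" unfolding blame_def by (simp only: other1 own if_True if_False)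
        then show False using not_A by simp
      qed
      have inf: "series_infinite 1 (\<lambda>n. ((walk w (2*n+1))\<^sup>2 - (walk w (2*n))\<^sup>2) / (2*n * ln (2*n)))"
      proof (rule ccontr)
        assume "\<not> series_infinite 1 (\<lambda>n. ((walk w (2*n+1))\<^sup>2 - (walk w (2*n))\<^sup>2) / (2*n * ln (2*n)))"
        then have "blame w = PlayerA"
          unfolding blame_def by (simp only: other1 other2 own if_False if_cancel)
        then show False using not_A by simp
      qed
      note other = other1 other2
      from small[OF other(1) own(1)] elim(3)
      have "series_infinite 2 (\<lambda>n. ((walk w (2*n))\<^sup>2 - (walk w (2*n-1))\<^sup>2) / ((2*n-1) * ln (2*n-1)))"
        unfolding PlayerB by (intro series_infinite_B) blast
      then show False
        using not_both_series_infinite[OF w small[OF other(1) own(1)] _ _ inf] own(2) other(2)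
        unfolding series_diverges_def by blast
    qed
  qed
qed

end

lemma measurable_term [measurable]:
  "(\<lambda>w. real_of_int (w i)) \<in> borel_measurable (play_law S)"
  by (rule measurable_compose[OF measurable_play_law_coord]) simp

lemma measurable_sums [measurable]:
  "(\<lambda>w. real_of_int (move_A w n)) \<in> borel_measurable (play_law S)"
  "(\<lambda>w. real_of_int (move_B w n)) \<in> borel_measurable (play_law S)"
  "(\<lambda>w. real_of_int (sum_A w n)) \<in> borel_measurable (play_law S)"
  "(\<lambda>w. real_of_int (sum_B w n)) \<in> borel_measurable (play_law S)"
  "(\<lambda>w. real_of_int (walk w n)) \<in> borel_measurable (play_law S)"
  unfolding sum_A_def sum_B_def move_A_def move_B_def term_at_def walk_eq of_int_sum of_int_add
  by measurable

text \<open>Countably many bounds suffice, which makes divergence to infinity a measurable condition.\<close>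

lemma filterlim_at_top_nat_bounds:
  fixes f :: "'a \<Rightarrow> real"
  shows "filterlim f at_top F \<longleftrightarrow> (\<forall>n::nat. eventually (\<lambda>x. real n \<le> f x) F)"
proof (intro iffI allI)
  assume "\<forall>n::nat. eventually (\<lambda>x. real n \<le> f x) F"
  then show "filterlim f at_top F"
    unfolding filterlim_at_top
    by (metis (mono_tags, lifting) eventually_mono order.trans real_arch_simple)
qed (auto simp: filterlim_at_top)

lemma pred_series_infinite:
  assumes [measurable]: "\<And>n. f n \<in> borel_measurable M"
  shows "Measurable.pred M (\<lambda>w. series_infinite m (\<lambda>n. f n w))"
  unfolding series_infinite_def filterlim_at_top_nat_bounds eventually_sequentially
  by measurable

lemma pred_series_diverges:
  assumes [measurable]: "\<And>n. f n \<in> borel_measurable M"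
  shows "Measurable.pred M (\<lambda>w. series_diverges m (\<lambda>n. f n w))"
  unfolding series_diverges_def Cauchy_convergent_iff[symmetric] metric_Cauchy_iff2
  by measurable

lemma pred_limsup_pos:
  assumes [measurable]: "\<And>n. f n \<in> borel_measurable M"
  shows "Measurable.pred M (\<lambda>w. 0 < limsup (\<lambda>n. ereal (f n w)))"
  by measurable

lemma measurable_blame [measurable]: "blame \<in> play_law S \<rightarrow>\<^sub>M count_space UNIV"
  unfolding blame_def[abs_def] of_int_diff of_int_power
  by (intro measurable_If predE pred_limsup_pos pred_series_diverges pred_series_infinite measurable_const
      borel_measurable_divide borel_measurable_diff borel_measurable_power measurable_sums
      borel_measurable_const UNIV_I | simp only: space_count_space)+

lemma sets_surviving_seqs [measurable]: "sign_seqs - D_set \<in> sets (play_law S)"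
proof -
  have "sign_seqs - D_set = {w \<in> space (play_law S). (\<forall>i. w i = -1 \<or> w i = 1) \<and>
      \<not> (\<exists>n\<ge>1. real_of_int (walk w n) = 0)}"
  proof -
    have "(\<Sum>i=1..n. term_at w i) = -1 \<longleftrightarrow> real_of_int (walk w n) = 0" for w n
      unfolding walk_def by linarith
    then show ?thesis
      unfolding D_set_def by (auto simp: sign_seqs_def space_play_law Pi_iff)
  qed
  also have "\<dots> \<in> sets (play_law S)" by measurable
  finally show ?thesis .
qed

theorem theorem3p1:
  fixes Honest Deviator :: player and \<sigma> :: strategy
  assumes "Honest \<noteq> Deviator"
    and "behavior_strategy Deviator \<sigma>"
  shows "{w \<in> sign_seqs - D_set. blame w = Honest}
           \<in> null_sets (play_law (\<lambda>p. if p = Honest then honest_strategy else \<sigma>))"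
proof -
  let ?S = "\<lambda>p. if p = Honest then honest_strategy else \<sigma>"
  interpret honest_play Honest ?S
  proof
    fix q
    have "q = Honest \<or> q = Deviator"
      using assms(1) by (cases q; cases Honest; cases Deviator) auto
    then show "behavior_strategy q (?S q)"
      using assms by (auto simp: behavior_strategy_def honest_strategy_def)
  qed simp
  have "{w \<in> sign_seqs - D_set. blame w = Honest} \<in> events"
  proof -
    have "{w \<in> sign_seqs - D_set. blame w = Honest}
        = (sign_seqs - D_set) \<inter> {w \<in> space (play_law ?S). blame w = Honest}"
      by (auto simp: space_play_law)
    also have "\<dots> \<in> events" by measurable
    finally show ?thesis .
  qed
  moreover have "AE w in play_law ?S. w \<notin> {w \<in> sign_seqs - D_set. blame w = Honest}"
    using AE_blame_not_honest by eventually_elim blast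
  ultimately show ?thesis by (simp add: AE_iff_null_sets)
qed

end
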